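(* Let $(M,F)$ be a Finsler manifold of dimension $n$, let $x\in M$, and let $\{X_1,\ldots,X_n\}$ be a Killing frame around $x$ for $F$. Let $(y^1,\ldots,y^n)$ be the linear fibre coordinates defined by $y=y^iX_i$, let $g_{ij}=\frac12[F^2]_{y^iy^j}$ with inverse matrix $(g^{ij})$, and define $c^k_{lj}$ by $[X_l,X_j](x)=c^k_{lj}X_k(x)$. Then for every nonzero $y\in T_xM$, the S-curvature at $(x,y)$ is $$S(x,y)=\frac12\,g^{il}c^k_{lj}[F^2]_{y^k}y^jI_i,$$ where $I_i=\big[\ln\sqrt{\det(g_{pq})}\big]_{y^i}$ are the coefficients of the mean Cartan torsion with respect to the basis of $T_xM$ induced by the Killing frame.
   Context: Summation over repeated indices is understood; subscripts such as $[F^2]_{y^k}$ denote partial derivatives. A Finsler metric on $M$ is a function $F:TM\setminus\{0\}\to\mathbb R^+$ that is smooth, positively homogeneous of degree $1$ on fibres, and whose fundamental tensor $\frac12[F^2]_{y^iy^j}$ (with respect to linear fibre coordinates) is positive definite at every $y\ne 0$. For a (local) vector field $X$ on $M$ with local flow $\rho_t$ and induced local flow $\tilde\rho_t$ (the differential of $\rho_t$) on $TM$, put $\tilde X(x,y)=\frac{d}{dt}\tilde\rho_t(x,y)|_{t=0}$. A Killing frame around $x$ is a set of local vector fields $X_1,\ldots,X_n$ ($n=\dim M$) on an open neighborhood $U$ of $x$ such that $X_1(x'),\ldots,X_n(x')$ is a basis of $T_{x'}M$ for each $x'\in U$, and $\tilde X_i(F)=0$ on $TU\setminus\{0\}$ for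 each $i$. S-curvature: in local coordinates $(\bar x^{\bar i})$ with induced fibre coordinates $y=\bar y^{\bar i}\partial_{\bar x^{\bar i}}$ and $\bar g_{\bar p\bar q}=\frac12[F^2]_{\bar y^{\bar p}\bar y^{\bar q}}$, the distortion function is $$\tau(x,y)=\ln\frac{\sqrt{\det(\bar g_{\bar p\bar q})}}{\sigma(x)},\qquad \sigma(x)=\frac{\mathrm{Vol}(B^n)}{\mathrm{Vol}\{(\bar y^{\bar i})\in\mathbb R^n: F(x,\bar y^{\bar i}\partial_{\bar x^{\bar i}})<1\}},$$ where $\mathrm{Vol}$ is Euclidean volume in $\mathbb R^n$ and $B^n$ is the open unit ball; $\tau$ does not depend on the choice of coordinates. The S-curvature $S(x,y)$, $y\neq0$, is the derivative of $\tau$ along the geodesic flow, i.e. $S(x,y)=\frac{d}{dt}\tau(\gamma(t),\dot\gamma(t))|_{t=0}$ where $\gamma$ is the geodesic with $\gamma(0)=x$, $\dot\gamma(0)=y$. Equivalently $S=G(\tau)$, where $$G=\bar y^{\bar i}\partial_{\bar x^{\bar i}}-\frac12\bar g^{\bar i\bar l}\big([F^2]_{\bar x^{\bar j}\bar y^{\bar l}}\bar y^{\bar j}-[F^2]_{\bar x^{\bar l}}\big)\partial_{\bar y^{\bar i}}$$ is the geodesic spray. *)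

theory Defs
  imports "HOL-Analysis.Analysis"
begin

section \<open>Smooth maps between normed spaces\<close>

text \<open>Intended for open \<open>S\<close> and finite-dimensional spaces, where testing all directional
  derivatives \<open>Df(x)v\<close> is the usual notion of \<open>C\<^sup>k\<close>.\<close>

primrec Ck_on :: "nat \<Rightarrow> 'a::real_normed_vector set \<Rightarrow> ('a \<Rightarrow> 'b::real_normed_vector) \<Rightarrow> bool" where
  "Ck_on 0 S f \<longleftrightarrow> continuous_on S f"
| "Ck_on (Suc k) S f \<longleftrightarrow> (\<forall>x\<in>S. f differentiable (at x)) \<and>
     (\<forall>v. Ck_on k S (\<lambda>x. frechet_derivative f (at x) v))"

definition smooth_on :: "'a::real_normed_vector set \<Rightarrow> ('a \<Rightarrow> 'b::real_normed_vector) \<Rightarrow> bool" where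
  "smooth_on S f \<longleftrightarrow> (\<forall>k. Ck_on k S f)"

definition partial_deriv :: "'n \<Rightarrow> (real^'n \<Rightarrow> real) \<Rightarrow> real^'n \<Rightarrow> real" where
  "partial_deriv i f y = deriv (\<lambda>t. f (y + t *\<^sub>R axis i 1)) 0"


section \<open>Smooth manifolds and tangent vectors\<close>

type_synonym ('a, 'n) chart = "'a set \<times> ('a \<Rightarrow> real^'n)"

abbreviation chart_dom :: "('a, 'n) chart \<Rightarrow> 'a set" where
  "chart_dom c \<equiv> fst c"

abbreviation coord :: "('a, 'n) chart \<Rightarrow> 'a \<Rightarrow> real^'n" where
  "coord c \<equiv> snd c"

abbreviation coord_inv :: "('a, 'n) chart \<Rightarrow> real^'n \<Rightarrow> 'a" where
  "coord_inv c \<equiv> inv_into (chart_dom c) (coord c)"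

text \<open>\<open>M\<close> is an open subset (possibly all) of a topological space; the Hausdorff and second
  countability axioms are expressed by the sort of the type of points.\<close>

definition smooth_manifold ::
    "'a::{t2_space,second_countable_topology} set \<Rightarrow> ('a, 'n::finite) chart set \<Rightarrow> bool" where
  "smooth_manifold M A \<longleftrightarrow>
     (\<Union>c\<in>A. chart_dom c) = M \<and>
     (\<forall>c\<in>A. open (chart_dom c) \<and> open (coord c ` chart_dom c) \<and>
        homeomorphism (chart_dom c) (coord c ` chart_dom c) (coord c) (coord_inv c)) \<and>
     (\<forall>c\<in>A. \<forall>d\<in>A.
        smooth_on (coord c ` (chart_dom c \<inter> chart_dom d)) (coord d \<circ> coord_inv c))"

text \<open>A tangent vector at \<open>p\<close> is the family of its components with respect to all charts around
  \<open>p\<close>, related by the Jacobians of the coordinate changes (and \<open>0\<close> elsewhere, so that equality of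
  tangent vectors is equality of functions). Vector space operations are componentwise.\<close>

type_synonym ('a, 'n) tvec = "('a, 'n) chart \<Rightarrow> real^'n"

definition tangent_space :: "('a, 'n::finite) chart set \<Rightarrow> 'a \<Rightarrow> ('a, 'n) tvec set" where
  "tangent_space A p = {v.
     (\<forall>c\<in>A. \<forall>d\<in>A. p \<in> chart_dom c \<and> p \<in> chart_dom d \<longrightarrow>
        v d = frechet_derivative (coord d \<circ> coord_inv c) (at (coord c p)) (v c)) \<and>
     (\<forall>c. \<not> (c \<in> A \<and> p \<in> chart_dom c) \<longrightarrow> v c = 0)}"

definition tvec_of_coords ::
    "('a, 'n::finite) chart set \<Rightarrow> ('a, 'n) chart \<Rightarrow> 'a \<Rightarrow> real^'n \<Rightarrow> ('a, 'n) tvec" where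
  "tvec_of_coords A c p y = (\<lambda>d. if d \<in> A \<and> p \<in> chart_dom d
     then frechet_derivative (coord d \<circ> coord_inv c) (at (coord c p)) y else 0)"

text \<open>The differential \<open>df\<^sub>p\<close>; the chart used at \<open>p\<close> is immaterial.\<close>

definition differential ::
    "('a, 'n::finite) chart set \<Rightarrow> ('a \<Rightarrow> 'a) \<Rightarrow> 'a \<Rightarrow> ('a, 'n) tvec \<Rightarrow> ('a, 'n) tvec" where
  "differential A f p v =
     (let c = (SOME c. c \<in> A \<and> p \<in> chart_dom c)
      in (\<lambda>d. if d \<in> A \<and> f p \<in> chart_dom d
              then frechet_derivative (coord d \<circ> f \<circ> coord_inv c) (at (coord c p)) (v c) else 0))"


section \<open>Vector fields, Lie brackets and flows\<close>

type_synonym ('a, 'n) vfield = "'a \<Rightarrow> ('a, 'n) tvec"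

definition smooth_vfield_on ::
    "('a, 'n::finite) chart set \<Rightarrow> 'a set \<Rightarrow> ('a, 'n) vfield \<Rightarrow> bool" where
  "smooth_vfield_on A U X \<longleftrightarrow>
     (\<forall>p\<in>U. X p \<in> tangent_space A p) \<and>
     (\<forall>c\<in>A. smooth_on (coord c ` (chart_dom c \<inter> U)) (\<lambda>x. X (coord_inv c x) c))"

text \<open>In coordinates \<open>[X,Y]\<^sup>i = X\<^sup>j \<partial>\<^sub>jY\<^sup>i - Y\<^sup>j \<partial>\<^sub>jX\<^sup>i\<close>, i.e. \<open>[X,Y] = XY - YX\<close> on functions.\<close>

definition lie_bracket ::
    "('a, 'n::finite) chart set \<Rightarrow> ('a, 'n) vfield \<Rightarrow> ('a, 'n) vfield \<Rightarrow> ('a, 'n) vfield" where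
  "lie_bracket A X Y p = (\<lambda>c. if c \<in> A \<and> p \<in> chart_dom c
     then frechet_derivative (\<lambda>x. Y (coord_inv c x) c) (at (coord c p)) (X p c)
        - frechet_derivative (\<lambda>x. X (coord_inv c x) c) (at (coord c p)) (Y p c)
     else 0)"

definition local_flow ::
    "('a::topological_space, 'n::finite) chart set \<Rightarrow> 'a set \<Rightarrow> ('a, 'n) vfield \<Rightarrow>
     'a \<Rightarrow> (real \<Rightarrow> 'a \<Rightarrow> 'a) \<Rightarrow> bool" where
  "local_flow A U X p \<rho> \<longleftrightarrow> (\<exists>\<epsilon> W. \<epsilon> > 0 \<and> open W \<and> p \<in> W \<and> W \<subseteq> U \<and>
     (\<forall>q\<in>W. \<rho> 0 q = q) \<and>
     (\<forall>t\<in>{-\<epsilon><..<\<epsilon>}. \<forall>q\<in>W. \<rho> t q \<in> U) \<and>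
     continuous_on ({-\<epsilon><..<\<epsilon>} \<times> W) (\<lambda>(t, q). \<rho> t q) \<and>
     (\<forall>c\<in>A. \<forall>d\<in>A.
        smooth_on {(t, x). t \<in> {-\<epsilon><..<\<epsilon>} \<and> x \<in> coord c ` (chart_dom c \<inter> W) \<and>
                           \<rho> t (coord_inv c x) \<in> chart_dom d}
          (\<lambda>(t, x). coord d (\<rho> t (coord_inv c x)))) \<and>
     (\<forall>t\<in>{-\<epsilon><..<\<epsilon>}. \<forall>q\<in>W. \<forall>c\<in>A. \<rho> t q \<in> chart_dom c \<longrightarrow>
        ((\<lambda>s. coord c (\<rho> s q)) has_vector_derivative X (\<rho> t q) c) (at t)))"

text \<open>The components, in the chart of the tangent bundle induced by \<open>c\<close>, of
  \<open>d/dt|\<^sub>t\<^sub>=\<^sub>0\<close> of the flow induced by \<open>\<rho>\<close> on the tangent bundle.\<close>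

definition lifted_field ::
    "('a, 'n::finite) chart set \<Rightarrow> (real \<Rightarrow> 'a \<Rightarrow> 'a) \<Rightarrow> ('a, 'n) chart \<Rightarrow>
     'a \<Rightarrow> ('a, 'n) tvec \<Rightarrow> (real^'n) \<times> (real^'n)" where
  "lifted_field A \<rho> c p v =
     vector_derivative (\<lambda>t. (coord c (\<rho> t p), differential A (\<rho> t) p v c)) (at 0)"


section \<open>Finsler metrics\<close>

definition local_rep ::
    "('a, 'n::finite) chart set \<Rightarrow> ('a \<Rightarrow> ('a, 'n) tvec \<Rightarrow> real) \<Rightarrow> ('a, 'n) chart \<Rightarrow>
     real^'n \<Rightarrow> real^'n \<Rightarrow> real" where
  "local_rep A F c x y = F (coord_inv c x) (tvec_of_coords A c (coord_inv c x) y)"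

text \<open>\<open>\<Phi>\<close> is the expression of the metric on one tangent space in linear fibre coordinates.\<close>

definition fundamental_tensor :: "(real^'n \<Rightarrow> real) \<Rightarrow> real^'n \<Rightarrow> real^'n^'n" where
  "fundamental_tensor \<Phi> y =
     (\<chi> i j. 1/2 * partial_deriv j (partial_deriv i (\<lambda>z. (\<Phi> z)\<^sup>2)) y)"

text \<open>Only the values of \<open>F\<close> at nonzero tangent vectors at points of \<open>M\<close> are constrained.\<close>

definition finsler_metric ::
    "'a set \<Rightarrow> ('a, 'n::finite) chart set \<Rightarrow> ('a \<Rightarrow> ('a, 'n) tvec \<Rightarrow> real) \<Rightarrow> bool" where
  "finsler_metric M A F \<longleftrightarrow>
     (\<forall>p\<in>M. \<forall>v\<in>tangent_space A p. v \<noteq> (\<lambda>_. 0) \<longrightarrow> F p v > 0) \<and>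
     (\<forall>p\<in>M. \<forall>v\<in>tangent_space A p. \<forall>r>0. v \<noteq> (\<lambda>_. 0) \<longrightarrow>
        F p (\<lambda>c. r *\<^sub>R v c) = r * F p v) \<and>
     (\<forall>c\<in>A. smooth_on ((coord c ` chart_dom c) \<times> (- {0})) (\<lambda>(x, y). local_rep A F c x y)) \<and>
     (\<forall>c\<in>A. \<forall>x\<in>coord c ` chart_dom c. \<forall>y. y \<noteq> 0 \<longrightarrow>
        (\<forall>u. u \<noteq> 0 \<longrightarrow> u \<bullet> (fundamental_tensor (local_rep A F c x) y *v u) > 0))"


section \<open>Killing frames\<close>

text \<open>A local flow of a smooth vector field exists around every point and its germ is unique, so
  the existential quantifier over \<open>\<rho>\<close> just names the flow of \<open>X\<close> near \<open>p\<close>.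
  The last line is \<open>dF\<close> evaluated, in induced coordinates, on the lifted field.\<close>

definition killing_field_on ::
    "('a::topological_space, 'n::finite) chart set \<Rightarrow> ('a \<Rightarrow> ('a, 'n) tvec \<Rightarrow> real) \<Rightarrow>
     'a set \<Rightarrow> ('a, 'n) vfield \<Rightarrow> bool" where
  "killing_field_on A F U X \<longleftrightarrow> smooth_vfield_on A U X \<and>
     (\<forall>p\<in>U. \<exists>\<rho>. local_flow A U X p \<rho> \<and>
        (\<forall>v\<in>tangent_space A p. v \<noteq> (\<lambda>_. 0) \<longrightarrow> (\<forall>c\<in>A. p \<in> chart_dom c \<longrightarrow>
           frechet_derivative (\<lambda>(x, y). local_rep A F c x y) (at (coord c p, v c))
             (lifted_field A \<rho> c p v) = 0)))"

definition frame_comb ::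
    "('n::finite \<Rightarrow> ('a, 'n) vfield) \<Rightarrow> 'a \<Rightarrow> real^'n \<Rightarrow> ('a, 'n) tvec" where
  "frame_comb X p a = (\<lambda>c. \<Sum>i\<in>UNIV. (a $ i) *\<^sub>R X i p c)"

definition killing_frame_on ::
    "'a::topological_space set \<Rightarrow> ('a, 'n::finite) chart set \<Rightarrow>
     ('a \<Rightarrow> ('a, 'n) tvec \<Rightarrow> real) \<Rightarrow> 'a set \<Rightarrow> ('n \<Rightarrow> ('a, 'n) vfield) \<Rightarrow> bool" where
  "killing_frame_on M A F U X \<longleftrightarrow> open U \<and> U \<subseteq> M \<and>
     (\<forall>i. killing_field_on A F U (X i)) \<and>
     (\<forall>p\<in>U. \<forall>v\<in>tangent_space A p. \<exists>!a. v = frame_comb X p a)"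


section \<open>S-curvature\<close>

text \<open>Coordinate expressions in a chart; \<open>H x y\<close> stands for \<open>F(x, y\<^sup>i \<partial>\<^sub>i)\<close>. The zero vector
  belongs to the unit ball by the convention \<open>F(x,0) = 0\<close>.\<close>

definition distortion :: "(real^'n \<Rightarrow> real^'n \<Rightarrow> real) \<Rightarrow> real^'n \<Rightarrow> real^'n \<Rightarrow> real" where
  "distortion H x y =
     (let \<sigma> = measure lebesgue (ball (0::real^'n) 1) / measure lebesgue {z. z = 0 \<or> H x z < 1}
      in ln (sqrt (det (fundamental_tensor (H x) y)) / \<sigma>))"

definition spray_apply ::
    "(real^'n \<Rightarrow> real^'n \<Rightarrow> real) \<Rightarrow> (real^'n \<Rightarrow> real^'n \<Rightarrow> real) \<Rightarrow> real^'n \<Rightarrow> real^'n \<Rightarrow> real" where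
  "spray_apply H f x y =
     (\<Sum>i\<in>UNIV. y $ i * partial_deriv i (\<lambda>x'. f x' y) x) -
     1/2 * (\<Sum>i\<in>UNIV. \<Sum>l\<in>UNIV. matrix_inv (fundamental_tensor (H x) y) $ i $ l *
        ((\<Sum>j\<in>UNIV. partial_deriv l (\<lambda>y'. partial_deriv j (\<lambda>x'. (H x' y')\<^sup>2) x) y * y $ j)
         - partial_deriv l (\<lambda>x'. (H x' y)\<^sup>2) x) *
        partial_deriv i (f x) y)"

text \<open>The S-curvature \<open>G(\<tau>)\<close> computed in the chart \<open>c\<close>, whose choice does not matter.\<close>

definition S_curvature ::
    "('a, 'n::finite) chart set \<Rightarrow> ('a \<Rightarrow> ('a, 'n) tvec \<Rightarrow> real) \<Rightarrow> ('a, 'n) chart \<Rightarrow>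
     'a \<Rightarrow> ('a, 'n) tvec \<Rightarrow> real" where
  "S_curvature A F c p v =
     spray_apply (local_rep A F c) (distortion (local_rep A F c)) (coord c p) (v c)"

definition mean_cartan_coeff :: "(real^'n \<Rightarrow> real) \<Rightarrow> 'n \<Rightarrow> real^'n \<Rightarrow> real" where
  "mean_cartan_coeff \<Phi> i = partial_deriv i (\<lambda>y. ln (sqrt (det (fundamental_tensor \<Phi> y))))"

end

theory Submission
  imports Defs
begin

text \<open>
  In a chart around \<open>x\<close> let \<open>E = F\<^sup>2\<close>, let \<open>y = y\<^sup>i X\<^sub>i(x)\<close>, and let \<open>Y = y\<^sup>i X\<^sub>i\<close> be the combination
  of the frame with these coefficients held constant, with derivative \<open>L\<close> at \<open>x\<close>. Like the frame
  fields, \<open>Y\<close> is a Killing field: its complete lift, which at \<open>(x, z)\<close> has the components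
  \<open>(y, L z)\<close>, annihilates \<open>E\<close> (\<open>killing_equation\<close>). The spray \<open>G\<close> and this lift have the same base
  component at \<open>(x, y)\<close>, so they differ by a vertical vector \<open>W\<close>.

  The distortion is invariant under Killing fields, so \<open>S = G(\<tau>) = W(\<tau>)\<close>. On a single tangent
  space \<open>\<tau>\<close> equals \<open>ln (sqrt (det g))\<close> up to a constant, and therefore \<open>S = W\<^sup>i I\<^sub>i\<close>. To find
  \<open>W\<close>, differentiate the Killing equation of \<open>Y\<close> along the fibre. This removes the mixed second
  derivatives of \<open>E\<close> from the spray and leaves
  \<open>2 g(w, W) = dE(0, L w) + dE(w, 0)\<close> for every tangent vector \<open>w\<close>. For \<open>w = X\<^sub>l\<close> the Killing
  equation of \<open>X\<^sub>l\<close> turns the right hand side into the derivative of \<open>E\<close> along the fibre in the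
  direction \<open>y\<^sup>j [X\<^sub>l, X\<^sub>j]\<close>, which is the formula of the theorem with its index lowered. This
  computation is \<open>S_curvature_from_killing_frame\<close>.

  The invariance of the distortion has two halves. Differentiating the Killing equation twice along
  the fibre gives the rate of change \<open>- (L\<^sup>T g + g L)\<close> of the fundamental tensor, hence the rate
  \<open>- tr L\<close> of \<open>ln (sqrt (det g))\<close> (\<open>log_density_invariant\<close>). The logarithm of the volume of the unit
  ball changes at the rate \<open>tr L\<close> (\<open>DERIV_body_volume\<close>). The reason is that, by the Killing
  equation, the linear maps \<open>1 + t L\<close> between the tangent spaces along a line preserve the norm up
  to a relative error \<open>o(t)\<close>, uniformly in the direction (\<open>almost_isometry\<close>), so that the unit ball
  is squeezed between two linear images of a fixed unit ball whose volumes are known to first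
  order. In this way the distortion is differentiable along every coordinate line, because every
  direction at \<open>x\<close> is a combination of the frame.
\<close>

section \<open>Directional derivatives of smooth maps\<close>

text \<open>The derivative in a fixed direction as a function of the point, so that it can be iterated.\<close>

definition dir_deriv ::
    "'a::real_normed_vector \<Rightarrow> ('a \<Rightarrow> 'b::real_normed_vector) \<Rightarrow> 'a \<Rightarrow> 'b" where
  "dir_deriv v f = (\<lambda>z. frechet_derivative f (at z) v)"

lemma has_derivative_dir_deriv:
  assumes "f differentiable (at z)"
  shows "(f has_derivative (\<lambda>v. dir_deriv v f z)) (at z)"
  using assms unfolding dir_deriv_def by (simp only: frechet_derivative_works)

lemma dir_deriv_eqI: "(f has_derivative f') (at z) \<Longrightarrow> dir_deriv v f z = f' v"
  unfolding dir_deriv_def by (simp only: frechet_derivative_at[symmetric])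

lemma linear_dir_deriv: "f differentiable (at z) \<Longrightarrow> linear (\<lambda>v. dir_deriv v f z)"
  unfolding dir_deriv_def by (rule linear_frechet_derivative)

lemma dir_deriv_cong_open:
  assumes "open S" "z \<in> S" "\<And>x. x \<in> S \<Longrightarrow> f x = g x" "f differentiable (at z)"
  shows "dir_deriv v g z = dir_deriv v f z"
  unfolding dir_deriv_def
  using frechet_derivative_transform_within_open[OF assms(4,1,2,3)] by simp

lemma differentiable_cong_open:
  assumes "open S" "z \<in> S" "\<And>x. x \<in> S \<Longrightarrow> f x = g x" "f differentiable (at z)"
  shows "g differentiable (at z)"
  using assms has_derivative_transform_within_open unfolding differentiable_def by blast

lemma Ck_on_SucD: "Ck_on (Suc k) S f \<Longrightarrow> Ck_on k S f"
proof (induction k arbitrary: f)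
  case 0
  then show ?case
    by (auto intro!: continuous_at_imp_continuous_on differentiable_imp_continuous_within)
next
  case (Suc k)
  then show ?case by (simp only: Ck_on.simps) blast
qed

lemma Ck_on_cong_open:
  assumes "open S" "\<And>x. x \<in> S \<Longrightarrow> f x = g x" "Ck_on k S f"
  shows "Ck_on k S g"
  using assms(2,3)
proof (induction k arbitrary: f g)
  case 0
  then show ?case by (simp cong: continuous_on_cong)
next
  case (Suc k)
  have "g differentiable (at x)" if "x \<in> S" for x
    using Suc.prems differentiable_cong_open[OF assms(1) that, of f g] that by auto
  moreover have "Ck_on k S (\<lambda>x. frechet_derivative g (at x) v)" for v
  proof (rule Suc.IH)
    show "Ck_on k S (\<lambda>x. frechet_derivative f (at x) v)" using Suc.prems by simp
    show "frechet_derivative f (at x) v = frechet_derivative g (at x) v" if "x \<in> S" for x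
      using Suc.prems dir_deriv_cong_open[OF assms(1) that, of f g v] that
      by (auto simp: dir_deriv_def)
  qed
  ultimately show ?case by simp
qed

lemma Ck_on_add:
  assumes "open S" "Ck_on k S f" "Ck_on k S g"
  shows "Ck_on k S (\<lambda>x. f x + g x)"
  using assms(2,3)
proof (induction k arbitrary: f g)
  case 0
  then show ?case by (simp add: continuous_on_add)
next
  case (Suc k)
  have d: "((\<lambda>x. f x + g x) has_derivative (\<lambda>v. dir_deriv v f x + dir_deriv v g x)) (at x)"
    if "x \<in> S" for x
    using Suc.prems that by (intro has_derivative_add has_derivative_dir_deriv) auto
  have "Ck_on k S (\<lambda>x. frechet_derivative (\<lambda>x. f x + g x) (at x) v)" for v
  proof (rule Ck_on_cong_open[OF assms(1)])
    show "Ck_on k S (\<lambda>x. dir_deriv v f x + dir_deriv v g x)"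
      using Suc.prems by (intro Suc.IH) (auto simp: dir_deriv_def)
    show "dir_deriv v f x + dir_deriv v g x = frechet_derivative (\<lambda>x. f x + g x) (at x) v"
      if "x \<in> S" for x
      using dir_deriv_eqI[OF d[OF that], of v] by (simp add: dir_deriv_def)
  qed
  then show ?case using d by (auto simp: differentiable_def)
qed

lemma Ck_on_mult:
  fixes f g :: "'a::real_normed_vector \<Rightarrow> real"
  assumes "open S" "Ck_on k S f" "Ck_on k S g"
  shows "Ck_on k S (\<lambda>x. f x * g x)"
  using assms(2,3)
proof (induction k arbitrary: f g)
  case 0
  then show ?case by (simp add: continuous_on_mult)
next
  case (Suc k)
  have d: "((\<lambda>x. f x * g x) has_derivative
      (\<lambda>v. f x * dir_deriv v g x + dir_deriv v f x * g x)) (at x)"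
    if "x \<in> S" for x
    using Suc.prems that by (intro has_derivative_mult has_derivative_dir_deriv) auto
  have "Ck_on k S (\<lambda>x. frechet_derivative (\<lambda>x. f x * g x) (at x) v)" for v
  proof (rule Ck_on_cong_open[OF assms(1)])
    show "Ck_on k S (\<lambda>x. f x * dir_deriv v g x + dir_deriv v f x * g x)"
      using Suc.prems Ck_on_SucD[OF Suc.prems(1)] Ck_on_SucD[OF Suc.prems(2)]
      by (intro Ck_on_add[OF assms(1)] Suc.IH) (auto simp: dir_deriv_def)
    show "f x * dir_deriv v g x + dir_deriv v f x * g x =
        frechet_derivative (\<lambda>x. f x * g x) (at x) v"
      if "x \<in> S" for x
      using dir_deriv_eqI[OF d[OF that], of v] by (simp add: dir_deriv_def)
  qed
  then show ?case using d by (auto simp: differentiable_def)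
qed

lemma smooth_on_square:
  fixes f :: "'a::real_normed_vector \<Rightarrow> real"
  assumes "open S" "smooth_on S f"
  shows "smooth_on S (\<lambda>x. (f x)\<^sup>2)"
  using assms Ck_on_mult unfolding smooth_on_def power2_eq_square by blast

lemma smooth_on_dir_deriv: "smooth_on S f \<Longrightarrow> smooth_on S (dir_deriv v f)"
  unfolding smooth_on_def dir_deriv_def
  by (metis Ck_on.simps(2))

lemma smooth_on_differentiable: "smooth_on S f \<Longrightarrow> x \<in> S \<Longrightarrow> f differentiable (at x)"
  unfolding smooth_on_def by (metis Ck_on.simps(2))

lemma smooth_on_continuous: "smooth_on S f \<Longrightarrow> continuous_on S f"
  unfolding smooth_on_def by (metis Ck_on.simps(1))

lemma dir_deriv_line:
  fixes g :: "'a::real_normed_vector \<Rightarrow> real"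
  assumes "g differentiable (at (a + s *\<^sub>R u))"
  shows "((\<lambda>s. g (a + s *\<^sub>R u)) has_real_derivative dir_deriv u g (a + s *\<^sub>R u)) (at s)"
proof -
  have "((\<lambda>s. a + s *\<^sub>R u) has_derivative (\<lambda>h. h *\<^sub>R u)) (at s)"
    by (auto intro!: derivative_eq_intros)
  from diff_chain_at[OF this has_derivative_dir_deriv[OF assms]]
  have "((\<lambda>s. g (a + s *\<^sub>R u)) has_derivative (\<lambda>h. dir_deriv (h *\<^sub>R u) g (a + s *\<^sub>R u))) (at s)"
    by (simp add: o_def)
  then show ?thesis
    by (simp add: has_field_derivative_def linear_cmul[OF linear_dir_deriv[OF assms]]
        mult.commute[of _ "dir_deriv u g (a + s *\<^sub>R u)"])
qed

text \<open>The mean value theorem, applied in direction \<open>v\<close> and then in direction \<open>w\<close>, expresses the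
  second difference by a second derivative at an intermediate point; the difference is symmetric
  in \<open>v\<close> and \<open>w\<close>, and so is the limit of the derivative.\<close>

lemma second_difference_mvt:
  fixes f :: "'a::real_normed_vector \<Rightarrow> real"
  assumes f: "\<And>x. x \<in> S \<Longrightarrow> f differentiable (at x)"
    and df: "\<And>x. x \<in> S \<Longrightarrow> dir_deriv v f differentiable (at x)"
    and r: "0 < r" "\<And>s t. 0 \<le> s \<Longrightarrow> s \<le> r \<Longrightarrow> 0 \<le> t \<Longrightarrow> t \<le> r \<Longrightarrow> z + s *\<^sub>R v + t *\<^sub>R w \<in> S"
  shows "\<exists>s t. 0 < s \<and> s < r \<and> 0 < t \<and> t < r \<and>
    f (z + r *\<^sub>R v + r *\<^sub>R w) - f (z + r *\<^sub>R v) - f (z + r *\<^sub>R w) + f z =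
      r * r * dir_deriv w (dir_deriv v f) (z + s *\<^sub>R v + t *\<^sub>R w)"
proof -
  let ?h = "\<lambda>s. f (z + r *\<^sub>R w + s *\<^sub>R v) - f (z + s *\<^sub>R v)"
  have "\<exists>s>0. s < r \<and> ?h r - ?h 0 =
      (r - 0) * (dir_deriv v f (z + r *\<^sub>R w + s *\<^sub>R v) - dir_deriv v f (z + s *\<^sub>R v))"
  proof (rule MVT2[OF r(1)])
    fix s assume "0 \<le> s" "s \<le> r"
    then show "(?h has_real_derivative
        dir_deriv v f (z + r *\<^sub>R w + s *\<^sub>R v) - dir_deriv v f (z + s *\<^sub>R v)) (at s)"
      using r(2)[of s r] r(2)[of s 0] r(1)
      by (intro DERIV_diff dir_deriv_line f) (auto simp: algebra_simps)
  qed
  then obtain s where s: "0 < s" "s < r" "?h r - ?h 0 =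
      r * (dir_deriv v f (z + r *\<^sub>R w + s *\<^sub>R v) - dir_deriv v f (z + s *\<^sub>R v))"
    by auto
  let ?k = "\<lambda>t. dir_deriv v f (z + s *\<^sub>R v + t *\<^sub>R w)"
  have "\<exists>t>0. t < r \<and> ?k r - ?k 0 = (r - 0) * dir_deriv w (dir_deriv v f) (z + s *\<^sub>R v + t *\<^sub>R w)"
    using s r by (intro MVT2[OF r(1)] dir_deriv_line df r(2)) auto
  then obtain t where t: "0 < t" "t < r"
      "?k r - ?k 0 = r * dir_deriv w (dir_deriv v f) (z + s *\<^sub>R v + t *\<^sub>R w)"
    by auto
  have "?h r - ?h 0 = r * (?k r - ?k 0)" using s(3) by (simp add: algebra_simps)
  with t s show ?thesis by (intro exI[of _ s] exI[of _ t]) (simp add: algebra_simps)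
qed

lemma dir_deriv_commute_real:
  fixes f :: "'a::real_normed_vector \<Rightarrow> real"
  assumes S: "open S" "z \<in> S" and f: "smooth_on S f"
  shows "dir_deriv w (dir_deriv v f) z = dir_deriv v (dir_deriv w f) z"
proof (rule ccontr)
  let ?P = "dir_deriv w (dir_deriv v f)" and ?Q = "dir_deriv v (dir_deriv w f)"
  assume "?P z \<noteq> ?Q z"
  define e where "e = \<bar>?P z - ?Q z\<bar> / 2"
  have e: "e > 0" using \<open>?P z \<noteq> ?Q z\<close> by (simp add: e_def)
  have cont: "isCont (dir_deriv a (dir_deriv b f)) z" for a b
    using S(2) smooth_on_continuous[OF smooth_on_dir_deriv[OF smooth_on_dir_deriv[OF f]]]
    unfolding continuous_on_eq_continuous_at[OF S(1)] by blast
  obtain d1 where d1: "d1 > 0" "\<And>x. dist x z < d1 \<Longrightarrow> dist (?P x) (?P z) < e"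
    using cont[of w v] e unfolding continuous_at_eps_delta by blast
  obtain d2 where d2: "d2 > 0" "\<And>x. dist x z < d2 \<Longrightarrow> dist (?Q x) (?Q z) < e"
    using cont[of v w] e unfolding continuous_at_eps_delta by blast
  note d = d1 d2
  obtain d3 where d3: "d3 > 0" "ball z d3 \<subseteq> S" using S openE by metis
  define m where "m = Min {d1, d2, d3}"
  define K where "K = norm v + norm w + 1"
  define r where "r = m / (2 * K)"
  have m: "m > 0" "m \<le> d1" "m \<le> d2" "m \<le> d3" using d d3 by (auto simp: m_def)
  have N: "K > 0" unfolding K_def by (smt (verit) norm_ge_zero)
  have r: "r > 0" using m N by (simp add: r_def)
  have close: "dist (z + s *\<^sub>R v + t *\<^sub>R w) z < m" if "0 \<le> s" "s \<le> r" "0 \<le> t" "t \<le> r" for s t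
  proof -
    have "dist (z + s *\<^sub>R v + t *\<^sub>R w) z = norm (s *\<^sub>R v + t *\<^sub>R w)"
      by (simp add: dist_norm algebra_simps)
    also have "\<dots> \<le> s * norm v + t * norm w"
      using that norm_triangle_ineq[of "s *\<^sub>R v" "t *\<^sub>R w"] by simp
    also have "\<dots> \<le> r * norm v + r * norm w"
      using that by (intro add_mono mult_right_mono) auto
    also have "\<dots> \<le> r * K" using r by (simp add: K_def algebra_simps)
    also have "\<dots> = m / 2" using N by (simp add: r_def)
    also have "\<dots> < m" using m by simp
    finally show ?thesis .
  qed
  have inS: "z + s *\<^sub>R v + t *\<^sub>R w \<in> S" if "0 \<le> s" "s \<le> r" "0 \<le> t" "t \<le> r" for s t
    using close[OF that] m d3 by (auto simp: subset_iff dist_commute)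
  \<comment> \<open>Both second derivatives, at points close to \<open>z\<close>, are the same difference quotient.\<close>
  note diff = smooth_on_differentiable[OF f] smooth_on_differentiable[OF smooth_on_dir_deriv[OF f]]
  obtain s t where st: "0 < s" "s < r" "0 < t" "t < r"
    "f (z + r *\<^sub>R v + r *\<^sub>R w) - f (z + r *\<^sub>R v) - f (z + r *\<^sub>R w) + f z =
      r * r * ?P (z + s *\<^sub>R v + t *\<^sub>R w)"
    using second_difference_mvt[of S f v r z w] diff r inS by blast
  have inS': "z + s *\<^sub>R w + t *\<^sub>R v \<in> S" if "0 \<le> s" "s \<le> r" "0 \<le> t" "t \<le> r" for s t
    using inS[of t s] that by (simp add: algebra_simps)
  obtain s' t' where st': "0 < s'" "s' < r" "0 < t'" "t' < r"
    "f (z + r *\<^sub>R w + r *\<^sub>R v) - f (z + r *\<^sub>R w) - f (z + r *\<^sub>R v) + f z =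
      r * r * ?Q (z + s' *\<^sub>R w + t' *\<^sub>R v)"
    using second_difference_mvt[of S f w r z v] diff r inS' by blast
  have "r * r * ?P (z + s *\<^sub>R v + t *\<^sub>R w) = r * r * ?Q (z + s' *\<^sub>R w + t' *\<^sub>R v)"
    using st(5) st'(5) by (simp add: algebra_simps)
  then have "?P (z + s *\<^sub>R v + t *\<^sub>R w) = ?Q (z + t' *\<^sub>R v + s' *\<^sub>R w)"
    using r by (simp add: algebra_simps)
  moreover have "dist (?P (z + s *\<^sub>R v + t *\<^sub>R w)) (?P z) < e"
    using close[of s t] st m by (intro d) auto
  moreover have "dist (?Q (z + t' *\<^sub>R v + s' *\<^sub>R w)) (?Q z) < e"
    using close[of t' s'] st' m by (intro d) auto
  ultimately show False by (simp add: dist_real_def e_def) (smt (verit) field_sum_of_halves)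
qed

lemma dir_deriv_inner:
  assumes "f differentiable (at z)"
  shows "dir_deriv v (\<lambda>x. f x \<bullet> b) z = dir_deriv v f z \<bullet> b"
  using assms by (intro dir_deriv_eqI has_derivative_inner_left has_derivative_dir_deriv)

lemma smooth_on_inner:
  fixes f :: "'a::real_normed_vector \<Rightarrow> 'b::real_inner"
  assumes "open S" "smooth_on S f"
  shows "smooth_on S (\<lambda>x. f x \<bullet> b)"
proof -
  have "Ck_on k S (\<lambda>x. f x \<bullet> b)" if "Ck_on k S f" for k
    using that
  proof (induction k arbitrary: f)
    case 0
    then show ?case by (auto intro!: continuous_intros)
  next
    case (Suc k)
    have "Ck_on k S (\<lambda>x. frechet_derivative (\<lambda>x. f x \<bullet> b) (at x) v)" for v
    proof (rule Ck_on_cong_open[OF assms(1)])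
      show "Ck_on k S (\<lambda>x. dir_deriv v f x \<bullet> b)"
        using Suc.prems by (intro Suc.IH) (auto simp: dir_deriv_def)
      show "dir_deriv v f x \<bullet> b = frechet_derivative (\<lambda>x. f x \<bullet> b) (at x) v" if "x \<in> S" for x
        using Suc.prems that dir_deriv_inner[of f x v b] by (simp add: dir_deriv_def)
    qed
    then show ?case using Suc.prems by auto
  qed
  then show ?thesis using assms(2) by (simp add: smooth_on_def)
qed

lemma dir_deriv_commute:
  fixes f :: "'a::real_normed_vector \<Rightarrow> 'b::euclidean_space"
  assumes S: "open S" "z \<in> S" and f: "smooth_on S f"
  shows "dir_deriv w (dir_deriv v f) z = dir_deriv v (dir_deriv w f) z"
proof (rule euclidean_eqI)
  fix b :: 'b
  have *: "dir_deriv w (dir_deriv v f) z \<bullet> b = dir_deriv w (dir_deriv v (\<lambda>x. f x \<bullet> b)) z" for v w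
  proof -
    have d: "dir_deriv v f differentiable (at z)"
      using S f smooth_on_differentiable smooth_on_dir_deriv by metis
    have "dir_deriv w (dir_deriv v f) z \<bullet> b = dir_deriv w (\<lambda>x. dir_deriv v f x \<bullet> b) z"
      using dir_deriv_inner[OF d] by simp
    also have "\<dots> = dir_deriv w (dir_deriv v (\<lambda>x. f x \<bullet> b)) z"
    proof (rule dir_deriv_cong_open[OF S, symmetric])
      show "(\<lambda>x. dir_deriv v f x \<bullet> b) differentiable (at z)" using d by simp
      show "dir_deriv v f x \<bullet> b = dir_deriv v (\<lambda>x. f x \<bullet> b) x" if "x \<in> S" for x
        using dir_deriv_inner[of f x] smooth_on_differentiable[OF f that] by simp
    qed
    finally show ?thesis .
  qed
  show "dir_deriv w (dir_deriv v f) z \<bullet> b = dir_deriv v (dir_deriv w f) z \<bullet> b"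
    unfolding * by (rule dir_deriv_commute_real[OF S smooth_on_inner[OF S(1) f]])
qed

lemma dir_deriv_eq_deriv_line:
  fixes g :: "'a::real_normed_vector \<Rightarrow> real"
  assumes "g differentiable (at a)"
  shows "deriv (\<lambda>t. g (a + t *\<^sub>R u)) 0 = dir_deriv u g a"
  using dir_deriv_line[of g a 0 u] assms by (intro DERIV_imp_deriv) simp

lemma partial_deriv_eq_dir_deriv:
  "f differentiable (at y) \<Longrightarrow> partial_deriv i f y = dir_deriv (axis i 1) f y"
  unfolding partial_deriv_def by (rule dir_deriv_eq_deriv_line)

lemma eventually_line_in_open:
  fixes a u :: "'a::real_normed_vector"
  assumes "open S" "a \<in> S"
  shows "\<forall>\<^sub>F t in nhds (0::real). a + t *\<^sub>R u \<in> S"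
proof -
  have "open ((\<lambda>t::real. a + t *\<^sub>R u) -` S)"
    by (intro open_vimage assms continuous_intros)
  from eventually_nhds_in_open[OF this, of 0] show ?thesis using assms by simp
qed

lemma partial_deriv_cong_open:
  assumes "open S" "y \<in> S" "\<And>z. z \<in> S \<Longrightarrow> f z = g z"
  shows "partial_deriv i f y = partial_deriv i g y"
  unfolding partial_deriv_def
  by (intro deriv_cong_ev eventually_mono[OF eventually_line_in_open[OF assms(1,2)]] assms(3)) auto

lemma dir_deriv_chain:
  assumes "(h has_derivative h') (at a)" "f differentiable (at (h a))"
  shows "dir_deriv v (\<lambda>x. f (h x)) a = dir_deriv (h' v) f (h a)"
  using diff_chain_at[OF assms(1) has_derivative_dir_deriv[OF assms(2)]]
  by (intro dir_deriv_eqI[THEN trans]) (auto simp: o_def)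

lemma
  assumes "f differentiable (at (x, y))"
  shows dir_deriv_fst_var: "dir_deriv u (\<lambda>x. f (x, y)) x = dir_deriv (u, 0) f (x, y)"
    and dir_deriv_snd_var: "dir_deriv v (\<lambda>y. f (x, y)) y = dir_deriv (0, v) f (x, y)"
    and differentiable_fst_var: "(\<lambda>x. f (x, y)) differentiable (at x)"
    and differentiable_snd_var: "(\<lambda>y. f (x, y)) differentiable (at y)"
proof -
  have 1: "((\<lambda>x. (x, y)) has_derivative (\<lambda>u. (u, 0))) (at x)"
    and 2: "((\<lambda>y. (x, y)) has_derivative (\<lambda>v. (0, v))) (at y)"
    by (auto intro!: derivative_eq_intros)
  show "dir_deriv u (\<lambda>x. f (x, y)) x = dir_deriv (u, 0) f (x, y)"
    using dir_deriv_chain[OF 1, of f] assms by simp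
  show "dir_deriv v (\<lambda>y. f (x, y)) y = dir_deriv (0, v) f (x, y)"
    using dir_deriv_chain[OF 2, of f] assms by simp
  show "(\<lambda>x. f (x, y)) differentiable (at x)"
    using diff_chain_at[OF 1 has_derivative_dir_deriv[OF assms]]
    unfolding differentiable_def o_def by blast
  show "(\<lambda>y. f (x, y)) differentiable (at y)"
    using diff_chain_at[OF 2 has_derivative_dir_deriv[OF assms]]
    unfolding differentiable_def o_def by blast
qed

lemma linear_axis_expansion:
  fixes l :: "real^'n \<Rightarrow> 'b::real_vector"
  assumes "linear l"
  shows "l v = (\<Sum>i\<in>UNIV. (v $ i) *\<^sub>R l (axis i 1))"
proof -
  have "l v = l (\<Sum>i\<in>UNIV. (v $ i) *\<^sub>R axis i 1)"
    by (simp add: basis_expansion scalar_mult_eq_scaleR[symmetric])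
  then show ?thesis by (simp add: linear_sum[OF assms] linear_cmul[OF assms] o_def)
qed

lemma dir_deriv_Pair_split:
  assumes "f differentiable (at z)"
  shows "dir_deriv (u, v) f z = dir_deriv (u, 0) f z + dir_deriv (0, v) f z"
  using linear_add[OF linear_dir_deriv[OF assms], of "(u, 0)" "(0, v)"] by simp

lemma linear_dir_deriv_fst: "f differentiable (at z) \<Longrightarrow> linear (\<lambda>u. dir_deriv (u, 0) f z)"
  using linear_compose[of "\<lambda>u. (u, 0)" "\<lambda>v. dir_deriv v f z"] linear_dir_deriv[of f z]
  by (auto simp: o_def linear_iff)

lemma linear_dir_deriv_snd: "f differentiable (at z) \<Longrightarrow> linear (\<lambda>v. dir_deriv (0, v) f z)"
  using linear_compose[of "\<lambda>u. (0, u)" "\<lambda>v. dir_deriv v f z"] linear_dir_deriv[of f z]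
  by (auto simp: o_def linear_iff)


section \<open>The derivative of the determinant\<close>

lemma has_derivative_vec_lambda:
  fixes f :: "'a::real_normed_vector \<Rightarrow> 'n::finite \<Rightarrow> 'b::euclidean_space"
  assumes "\<And>i. ((\<lambda>z. f z i) has_derivative (\<lambda>h. f' h i)) (at x)"
  shows "((\<lambda>z. \<chi> i. f z i) has_derivative (\<lambda>h. \<chi> i. f' h i)) (at x)"
  by (subst has_derivative_componentwise_within)
     (auto simp: Basis_vec_def inner_axis intro!: has_derivative_inner_left assms)

lemma det_differentiable: "det differentiable (at (G :: real^'n^'n))"
  unfolding det_def[abs_def]
  by (intro differentiable_sum differentiable_mult differentiable_const ballI)
     (auto simp: differentiable_def
        intro!: exI has_derivative_prod bounded_linear_imp_has_derivative
          bounded_linear_compose[OF bounded_linear_vec_nth bounded_linear_vec_nth])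

text \<open>This is the trace of \<open>L\<close>. It is kept as the derivative of the determinant because it enters
  through determinants: once through the volume of the unit ball of the norm and once through the
  fundamental tensor, and the two contributions cancel in the distortion.\<close>

definition det_rate :: "real^'n^'n \<Rightarrow> real" where
  "det_rate L = dir_deriv L det (mat 1)"

lemma linear_det_rate: "linear det_rate"
  unfolding det_rate_def[abs_def] by (rule linear_dir_deriv[OF det_differentiable])

lemma DERIV_det_line: "((\<lambda>t. det (G + t *\<^sub>R X)) has_real_derivative dir_deriv X det G) (at 0)"
  for G :: "real^'n^'n"
  using dir_deriv_line[of det G 0 X, OF det_differentiable] by simp

lemma DERIV_det_rate: "((\<lambda>t. det (mat 1 + t *\<^sub>R L)) has_real_derivative det_rate L) (at 0)"
  for L :: "real^'n^'n"
  unfolding det_rate_def by (rule DERIV_det_line)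

lemma det_rate_transpose: "det_rate (transpose L) = det_rate L"
proof -
  have "det (mat 1 + t *\<^sub>R transpose L) = det (mat 1 + t *\<^sub>R L)" for t
  proof -
    have "mat 1 + t *\<^sub>R transpose L = transpose (mat 1 + t *\<^sub>R L)"
      by (simp add: transpose_def vec_eq_iff mat_def)
    then show ?thesis by simp
  qed
  then show ?thesis using DERIV_det_rate[of L] DERIV_det_rate[of "transpose L"] DERIV_unique by auto
qed

text \<open>By multiplicativity \<open>det (G + t L G) = det (1 + t L) det G\<close>.\<close>

lemma
  fixes G :: "real^'n^'n"
  shows dir_deriv_det_mult_left: "dir_deriv (L ** G) det G = det_rate L * det G"
    and dir_deriv_det_mult_right: "dir_deriv (G ** L) det G = det_rate L * det G"
proof -
  have "G + t *\<^sub>R (L ** G) = (mat 1 + t *\<^sub>R L) ** G" "G + t *\<^sub>R (G ** L) = G ** (mat 1 + t *\<^sub>R L)" for t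
  proof -
    have "(mat 1 + t *\<^sub>R L) ** G = mat 1 ** G + t *\<^sub>R (L ** G)"
      by (simp add: vec_eq_iff matrix_matrix_mult_def sum_distrib_left algebra_simps sum.distrib
          del: matrix_mul_lid)
    then show "G + t *\<^sub>R (L ** G) = (mat 1 + t *\<^sub>R L) ** G" by simp
    have "G ** (mat 1 + t *\<^sub>R L) = G ** mat 1 + t *\<^sub>R (G ** L)"
      by (simp add: vec_eq_iff matrix_matrix_mult_def sum_distrib_left algebra_simps sum.distrib
          del: matrix_mul_rid)
    then show "G + t *\<^sub>R (G ** L) = G ** (mat 1 + t *\<^sub>R L)" by simp
  qed
  then have *: "det (G + t *\<^sub>R (L ** G)) = det (mat 1 + t *\<^sub>R L) * det G"
    "det (G + t *\<^sub>R (G ** L)) = det (mat 1 + t *\<^sub>R L) * det G" for t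
    by (simp_all add: det_mul)
  have d: "((\<lambda>t. det (mat 1 + t *\<^sub>R L) * det G) has_real_derivative det_rate L * det G) (at 0)"
    by (intro DERIV_cmult_right DERIV_det_rate)
  show "dir_deriv (L ** G) det G = det_rate L * det G"
    using DERIV_det_line[of G "L ** G"] d unfolding * by (rule DERIV_unique)
  show "dir_deriv (G ** L) det G = det_rate L * det G"
    using DERIV_det_line[of G "G ** L"] d unfolding * by (rule DERIV_unique)
qed

lemma pos_def_det_pos:
  fixes G :: "real^'n^'n"
  assumes "\<And>u. u \<noteq> 0 \<Longrightarrow> u \<bullet> (G *v u) > 0"
  shows "det G > 0"
proof (rule ccontr)
  \<comment> \<open>On the segment from the identity to \<open>G\<close> all matrices are positive definite.\<close>
  define q where "q t = det ((1 - t) *\<^sub>R mat 1 + t *\<^sub>R G)" for t :: real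
  assume "\<not> det G > 0"
  then have "q 1 \<le> 0" "0 \<le> q 0" by (simp_all add: q_def)
  moreover have "continuous_on {0..1} q"
  proof -
    have "continuous_on UNIV (det :: real^'n^'n \<Rightarrow> real)"
      using det_differentiable
      by (intro continuous_at_imp_continuous_on ballI differentiable_imp_continuous_within)
    from continuous_on_compose2[OF this, of "{0..1}" "\<lambda>t. (1 - t) *\<^sub>R mat 1 + t *\<^sub>R G"]
    show ?thesis unfolding q_def by (simp add: continuous_intros)
  qed
  ultimately obtain t where t: "0 \<le> t" "t \<le> 1" "q t = 0"
    using IVT2'[of q 1 0 0] by auto
  have "q t \<noteq> 0"
    unfolding q_def invertible_det_nz[symmetric] invertible_left_inverse matrix_left_invertible_ker
  proof (intro allI impI, rule ccontr)
    fix u :: "real^'n"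
    assume u: "((1 - t) *\<^sub>R mat 1 + t *\<^sub>R G) *v u = 0" "u \<noteq> 0"
    have "0 = u \<bullet> (((1 - t) *\<^sub>R mat 1 + t *\<^sub>R G) *v u)" using u by simp
    also have "\<dots> = (1 - t) * (u \<bullet> u) + t * (u \<bullet> (G *v u))"
      by (simp add: matrix_vector_mult_add_rdistrib scaleR_matrix_vector_assoc[symmetric]
          inner_add_right)
    also have "\<dots> > 0"
    proof (cases "t = 0")
      case False
      then show ?thesis using t assms[OF u(2)] by (intro add_nonneg_pos) auto
    qed (use u in simp)
    finally show False by simp
  qed
  with t show False by simp
qed

lemma matrix_inv_mult:
  fixes G :: "real^'n^'n"
  assumes "det G \<noteq> 0"
  shows "G ** matrix_inv G = mat 1" "matrix_inv G ** G = mat 1"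
  using assms someI_ex[of "\<lambda>B. G ** B = mat 1 \<and> B ** G = mat 1"]
  unfolding invertible_det_nz[symmetric] invertible_def matrix_inv_def by auto


section \<open>Volumes of linear images\<close>

text \<open>The elementary linear maps multiply Lebesgue measure by the absolute value of their
  determinant, hence so do all linear maps. The coordinates carry no order, so a shear need not be
  triangular; its determinant comes from a row operation.\<close>

definition scales_by_det :: "(real^'n \<Rightarrow> real^'n) \<Rightarrow> bool" where
  "scales_by_det f \<longleftrightarrow> linear f \<and> (\<forall>S\<in>lmeasurable. f ` S \<in> lmeasurable \<and>
     measure lebesgue (f ` S) = \<bar>det (matrix f)\<bar> * measure lebesgue S)"

lemma scales_by_det_comp:
  assumes "scales_by_det f" "scales_by_det g"
  shows "scales_by_det (f \<circ> g)"
proof -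
  have "(f \<circ> g) ` S = f ` g ` S" for S by (rule image_comp[symmetric])
  then show ?thesis
    using assms unfolding scales_by_det_def
    by (simp only: linear_compose matrix_compose det_mul abs_mult) (simp add: mult.assoc)
qed

lemma scales_by_det_stretch: "scales_by_det (\<lambda>x. \<chi> i. c i * x $ i)" for c :: "'n::finite \<Rightarrow> real"
  unfolding scales_by_det_def
proof (intro conjI ballI)
  show "linear (\<lambda>x. \<chi> i. c i * x $ i)"
    by (rule linearI) (simp_all add: vec_eq_iff algebra_simps)
  fix S :: "(real^'n) set" assume S: "S \<in> lmeasurable"
  show "(\<lambda>x. \<chi> i. c i * x $ i) ` S \<in> lmeasurable" by (rule measurable_stretch[OF S])
  have "det (matrix (\<lambda>x. \<chi> i. c i * x $ i)) = prod c UNIV"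
    by (subst det_diagonal) (auto simp: matrix_def axis_def)
  then show "measure lebesgue ((\<lambda>x. \<chi> i. c i * x $ i) ` S) =
      \<bar>det (matrix (\<lambda>x. \<chi> i. c i * x $ i))\<bar> * measure lebesgue S"
    using measure_stretch[OF S, of c] by simp
qed

lemma scales_by_det_shear:
  fixes m n :: "'n::finite"
  assumes "m \<noteq> n"
  shows "scales_by_det (\<lambda>x :: real^'n. \<chi> i. if i = m then x $ m + x $ n else x $ i)" (is "scales_by_det ?f")
proof -
  have lin: "linear ?f"
    by (rule linearI) (auto simp: vec_eq_iff algebra_simps)
  have "matrix ?f = (\<chi> k. if k = m then row m (mat 1) + 1 *s row n (mat 1) else row k (mat 1))"
    by (auto simp: matrix_def vec_eq_iff row_def mat_def axis_def)
  then have det: "det (matrix ?f) = 1"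
    using det_row_operation[OF assms, of "mat 1" 1] by simp
  have "measure lebesgue (?f ` cbox a b) = 1 * measure lebesgue (cbox a b)" for a b
  proof (cases "cbox a b = {}")
    case False
    \<comment> \<open>Move the corner \<open>a\<close> of the box to the origin.\<close>
    have box: "cbox a b = (+) a ` cbox 0 (b - a)" by (simp add: cbox_translation[symmetric])
    then have "cbox 0 (b - a) \<noteq> {}" using False by auto
    from measure_shear_interval[OF assms this]
    have "measure lebesgue (?f ` cbox 0 (b - a)) = measure lebesgue (cbox 0 (b - a))" by simp
    moreover have "?f ` cbox a b = (+) (?f a) ` ?f ` cbox 0 (b - a)"
      unfolding box image_image linear_add[OF lin] ..
    ultimately show ?thesis unfolding box by (simp only: measure_translation mult_1)
  qed simp
  note image = measure_linear_sufficient[OF lin _ this]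
  show ?thesis
    unfolding scales_by_det_def det abs_one
  proof (intro conjI ballI lin)
    fix S :: "(real^'n) set" assume S: "S \<in> lmeasurable"
    show "?f ` S \<in> lmeasurable" "measure lebesgue (?f ` S) = 1 * measure lebesgue S"
      by (rule image[OF S, THEN conjunct1]) (rule image[OF S, THEN conjunct2, symmetric])
  qed
qed

text \<open>A transposition of coordinates is a product of shears and reflections:
  \<open>(p, q) \<mapsto> (p + q, q) \<mapsto> (p + q, - p) \<mapsto> (q, - p) \<mapsto> (q, p)\<close>, where subtracting is adding
  conjugated by a reflection.\<close>

lemma scales_by_det_transpose:
  fixes m n :: "'n::finite"
  assumes "m \<noteq> n"
  shows "scales_by_det (\<lambda>x :: real^'n. \<chi> i. x $ Transposition.transpose m n i)"
proof -
  let ?shear = "\<lambda>m n (x :: real^'n). \<chi> i. if i = m then x $ m + x $ n else x $ i"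
  let ?neg = "\<lambda>k (x :: real^'n). \<chi> i. (if i = k then - 1 else 1) * x $ i"
  have "(\<lambda>x. \<chi> i. x $ Transposition.transpose m n i) =
      ?neg n \<circ> (?shear m n \<circ> (?neg m \<circ> (?shear n m \<circ> (?neg m \<circ> ?shear m n))))"
    using assms by (auto simp: fun_eq_iff vec_eq_iff Transposition.transpose_def)
  then show ?thesis
    using assms scales_by_det_shear[of m n] scales_by_det_shear[of n m] scales_by_det_stretch
    by (simp only:) (intro scales_by_det_comp; simp)
qed

lemma linear_scales_by_det:
  assumes "linear f"
  shows "scales_by_det f"
proof (rule induct_linear_elementary[OF assms])
  fix f :: "real^'n \<Rightarrow> real^'n" and i
  assume f: "linear f" "\<And>x. f x $ i = 0"
  have "\<not> surj f"
  proof
    assume "surj f"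
    then obtain z where "f z = axis i 1" by (metis surjD)
    with f(2)[of z] show False by simp
  qed
  then have "\<not> inj f" using linear_injective_imp_surjective[OF f(1)] by blast
  then have "det (matrix f) = 0" "negligible (f ` S)" for S
    using det_nz_iff_inj[OF f(1)] negligible_linear_singular_image[OF f(1)] by auto
  then show "scales_by_det f"
    using f(1) negligible_iff_measure by (auto simp: scales_by_det_def)
qed (assumption | rule scales_by_det_comp scales_by_det_stretch scales_by_det_shear
    scales_by_det_transpose)+

lemma
  fixes P :: "real^'n^'n" and S :: "(real^'n) set"
  assumes "S \<in> lmeasurable"
  shows lmeasurable_scaled_image: "(\<lambda>y. r *\<^sub>R (P *v y)) ` S \<in> lmeasurable"
    and measure_scaled_image: "measure lebesgue ((\<lambda>y. r *\<^sub>R (P *v y)) ` S) =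
      \<bar>r\<bar> ^ CARD('n) * \<bar>det P\<bar> * measure lebesgue S"
proof -
  have lin: "linear (\<lambda>y. r *\<^sub>R (P *v y))"
    using linear_compose[OF matrix_vector_mul_linear[of P] linear_scaleR[of r]] by (simp add: o_def)
  show "(\<lambda>y. r *\<^sub>R (P *v y)) ` S \<in> lmeasurable" using linear_scales_by_det[OF lin] assms by (simp add: scales_by_det_def)
  have "matrix (\<lambda>y. r *\<^sub>R (P *v y)) = matrix ((*\<^sub>R) r) ** P"
    using matrix_compose[OF matrix_vector_mul_linear[of P] linear_scaleR[of r]] by (simp add: o_def)
  then show "measure lebesgue ((\<lambda>y. r *\<^sub>R (P *v y)) ` S) =
      \<bar>r\<bar> ^ CARD('n) * \<bar>det P\<bar> * measure lebesgue S"
    using linear_scales_by_det[OF lin] assms by (simp add: scales_by_det_def det_mul abs_mult power_abs)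
qed


section \<open>The fundamental tensor in a chart\<close>

locale finsler_chart =
  fixes V :: "(real^'n::finite) set" and H :: "real^'n \<Rightarrow> real^'n \<Rightarrow> real"
  assumes open_V: "open V"
    and smooth_H: "smooth_on (V \<times> (- {0})) (\<lambda>(x, y). H x y)"
    and pos: "x \<in> V \<Longrightarrow> y \<noteq> 0 \<Longrightarrow> H x y > 0"
    and homogeneous: "x \<in> V \<Longrightarrow> y \<noteq> 0 \<Longrightarrow> r > 0 \<Longrightarrow> H x (r *\<^sub>R y) = r * H x y"
    and pos_def: "x \<in> V \<Longrightarrow> y \<noteq> 0 \<Longrightarrow> u \<noteq> 0 \<Longrightarrow> u \<bullet> (fundamental_tensor (H x) y *v u) > 0"
begin

definition energy :: "(real^'n) \<times> (real^'n) \<Rightarrow> real" where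
  "energy z = (H (fst z) (snd z))\<^sup>2"

definition tensor :: "(real^'n) \<times> (real^'n) \<Rightarrow> real^'n^'n" where
  "tensor z = fundamental_tensor (H (fst z)) (snd z)"

text \<open>The part of the distortion that depends on the direction; the rest is a function of the base
  point. Its derivatives along the fibre are the mean Cartan torsion.\<close>

definition log_density :: "(real^'n) \<times> (real^'n) \<Rightarrow> real" where
  "log_density z = ln (sqrt (det (tensor z)))"

lemma open_slit: "open (V \<times> (- {0 :: real^'n}))"
  by (intro open_Times open_V) auto

lemma smooth_energy: "smooth_on (V \<times> (- {0})) energy"
  using smooth_on_square[OF open_slit smooth_H] by (simp add: energy_def[abs_def] case_prod_unfold)

lemma diff_at:
  "smooth_on (V \<times> (- {0})) f \<Longrightarrow> x \<in> V \<Longrightarrow> y \<noteq> 0 \<Longrightarrow> f differentiable (at (x, y))"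
  by (rule smooth_on_differentiable) auto

lemmas diff_energy = diff_at[OF smooth_energy]
lemmas diff_energy' = diff_at[OF smooth_on_dir_deriv[OF smooth_energy]]
lemmas diff_energy'' = diff_at[OF smooth_on_dir_deriv[OF smooth_on_dir_deriv[OF smooth_energy]]]

lemma commute_at:
  fixes f :: "(real^'n) \<times> (real^'n) \<Rightarrow> real"
  assumes "smooth_on (V \<times> (- {0})) f" "x \<in> V" "y \<noteq> 0"
  shows "dir_deriv a (dir_deriv b f) (x, y) = dir_deriv b (dir_deriv a f) (x, y)"
  using assms by (intro dir_deriv_commute[OF open_slit]) auto

text \<open>The linear vector field \<open>y \<mapsto> L y\<close> on the fibre does not commute with the constant field \<open>a\<close>:
  the direction of differentiation depends on \<open>y\<close>, and its derivative \<open>L a\<close> is the extra term.\<close>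

lemma dir_deriv_complete_lift:
  fixes f :: "(real^'n) \<times> (real^'n) \<Rightarrow> real"
  assumes f: "smooth_on (V \<times> (- {0})) f" and x: "x \<in> V" and y: "y \<noteq> 0"
  shows "dir_deriv a (\<lambda>y. dir_deriv (w, L *v y) f (x, y)) y =
    dir_deriv (w, L *v y) (dir_deriv (0, a) f) (x, y) + dir_deriv (0, L *v a) f (x, y)"
proof -
  note f' = smooth_on_dir_deriv[OF f]
  have expand: "dir_deriv (w, v) h (x, y) = dir_deriv (w, 0) h (x, y) +
      (\<Sum>i\<in>UNIV. v $ i * dir_deriv (0, axis i 1) h (x, y))"
    if "smooth_on (V \<times> (- {0})) h" "y \<noteq> 0" for h :: "(real^'n) \<times> (real^'n) \<Rightarrow> real" and v y
    using dir_deriv_Pair_split[OF diff_at[OF that(1) x that(2)], of w v]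
      linear_axis_expansion[OF linear_dir_deriv_snd[OF diff_at[OF that(1) x that(2)]], of v] by simp
  have fibre: "((\<lambda>y. dir_deriv u f (x, y)) has_derivative
      (\<lambda>a. dir_deriv (0, a) (dir_deriv u f) (x, y))) (at y)" for u
    using has_derivative_dir_deriv[OF differentiable_snd_var[OF diff_at[OF f' x y]]]
    by (simp add: dir_deriv_snd_var[OF diff_at[OF f' x y]])
  have coord: "((\<lambda>y. (L *v y) $ i) has_derivative (\<lambda>a. (L *v a) $ i)) (at y)" for i
    by (intro bounded_linear_imp_has_derivative bounded_linear_compose[OF bounded_linear_vec_nth]
        matrix_vector_mul_bounded_linear)
  let ?h = "\<lambda>y. dir_deriv (w, 0) f (x, y) +
      (\<Sum>i\<in>UNIV. (L *v y) $ i * dir_deriv (0, axis i 1) f (x, y))"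
  have h: "(?h has_derivative (\<lambda>a. dir_deriv (0, a) (dir_deriv (w, 0) f) (x, y) +
      (\<Sum>i\<in>UNIV. (L *v y) $ i * dir_deriv (0, a) (dir_deriv (0, axis i 1) f) (x, y) +
        (L *v a) $ i * dir_deriv (0, axis i 1) f (x, y)))) (at y)"
    by (intro has_derivative_add has_derivative_sum has_derivative_mult fibre coord)
  have "dir_deriv a (\<lambda>y. dir_deriv (w, L *v y) f (x, y)) y = dir_deriv a ?h y"
  proof (rule dir_deriv_cong_open[of "- {0}"])
    show "?h y = dir_deriv (w, L *v y) f (x, y)" if "y \<in> - {0}" for y
      using that by (intro expand[OF f, symmetric]) simp
  qed (use y h in \<open>auto simp: differentiable_def\<close>)
  also have "\<dots> = dir_deriv (0, a) (dir_deriv (w, 0) f) (x, y) +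
      (\<Sum>i\<in>UNIV. (L *v y) $ i * dir_deriv (0, a) (dir_deriv (0, axis i 1) f) (x, y) +
        (L *v a) $ i * dir_deriv (0, axis i 1) f (x, y))"
    by (rule dir_deriv_eqI[OF h])
  also have "\<dots> = dir_deriv (w, 0) (dir_deriv (0, a) f) (x, y) +
      (\<Sum>i\<in>UNIV. (L *v y) $ i * dir_deriv (0, axis i 1) (dir_deriv (0, a) f) (x, y)) +
      (\<Sum>i\<in>UNIV. (L *v a) $ i * dir_deriv (0, axis i 1) f (x, y))"
    by (simp add: commute_at[OF f x y, of "(0, a)"] sum.distrib)
  also have "\<dots> = dir_deriv (w, L *v y) (dir_deriv (0, a) f) (x, y) + dir_deriv (0, L *v a) f (x, y)"
    using expand[OF f' y, of "L *v y" "(0, a)"]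
      linear_axis_expansion[OF linear_dir_deriv_snd[OF diff_at[OF f x y]], of "L *v a"] by simp
  finally show ?thesis .
qed

lemma partial_deriv_energy:
  assumes "x \<in> V" "y \<noteq> 0"
  shows "partial_deriv i (\<lambda>z. (H x z)\<^sup>2) y = dir_deriv (0, axis i 1) energy (x, y)"
    and "partial_deriv i (\<lambda>x. (H x y)\<^sup>2) x = dir_deriv (axis i 1, 0) energy (x, y)"
  using partial_deriv_eq_dir_deriv[OF differentiable_snd_var[OF diff_energy[OF assms]], of i]
    partial_deriv_eq_dir_deriv[OF differentiable_fst_var[OF diff_energy[OF assms]], of i]
    dir_deriv_snd_var[OF diff_energy[OF assms]] dir_deriv_fst_var[OF diff_energy[OF assms]]
  by (simp_all add: energy_def)

lemma tensor_nth:
  assumes "x \<in> V" "y \<noteq> 0"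
  shows "tensor (x, y) $ i $ j =
    1/2 * dir_deriv (0, axis j 1) (dir_deriv (0, axis i 1) energy) (x, y)"
proof -
  have "partial_deriv j (partial_deriv i (\<lambda>z. (H x z)\<^sup>2)) y =
      partial_deriv j (\<lambda>z. dir_deriv (0, axis i 1) energy (x, z)) y"
    using assms by (intro partial_deriv_cong_open[of "- {0}"] partial_deriv_energy) auto
  also have "\<dots> = dir_deriv (0, axis j 1) (dir_deriv (0, axis i 1) energy) (x, y)"
    using assms by (simp add: partial_deriv_eq_dir_deriv[OF differentiable_snd_var]
        dir_deriv_snd_var diff_energy')
  finally show ?thesis by (simp add: tensor_def fundamental_tensor_def)
qed

lemma tensor_bilinear:
  assumes "x \<in> V" "y \<noteq> 0"
  shows "a \<bullet> (tensor (x, y) *v b) = 1/2 * dir_deriv (0, b) (dir_deriv (0, a) energy) (x, y)"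
proof -
  note lin = linear_axis_expansion[OF linear_dir_deriv_snd[OF diff_energy'[OF assms]]]
  have "1/2 * dir_deriv (0, b) (dir_deriv (0, a) energy) (x, y) =
      (\<Sum>j\<in>UNIV. b $ j * (1/2 * dir_deriv (0, a) (dir_deriv (0, axis j 1) energy) (x, y)))"
    by (subst lin) (simp add: sum_distrib_left commute_at[OF smooth_energy assms, of _ "(0, a)"]
        algebra_simps)
  also have "\<dots> = (\<Sum>j\<in>UNIV. b $ j * (\<Sum>i\<in>UNIV. a $ i * tensor (x, y) $ i $ j))"
    by (subst lin) (simp add: sum_distrib_left tensor_nth[OF assms] algebra_simps
        commute_at[OF smooth_energy assms, of "(0, axis _ 1)" "(0, axis _ 1)"])
  also have "\<dots> = a \<bullet> (tensor (x, y) *v b)"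
    by (simp add: inner_vec_def matrix_vector_mult_def sum_distrib_left algebra_simps)
       (rule sum.swap)
  finally show ?thesis by simp
qed

lemma det_tensor_pos: "x \<in> V \<Longrightarrow> y \<noteq> 0 \<Longrightarrow> det (tensor (x, y)) > 0"
  by (rule pos_def_det_pos) (simp add: tensor_def pos_def)

lemma has_derivative_tensor:
  assumes "x \<in> V" "y \<noteq> 0"
  shows "(tensor has_derivative (\<lambda>h. \<chi> i j. 1/2 *
    dir_deriv h (dir_deriv (0, axis j 1) (dir_deriv (0, axis i 1) energy)) (x, y))) (at (x, y))"
proof (rule has_derivative_transform_within_open[OF _ open_slit])
  show "((\<lambda>z. \<chi> i j. 1/2 * dir_deriv (0, axis j 1) (dir_deriv (0, axis i 1) energy) z)
      has_derivative (\<lambda>h. \<chi> i j. 1/2 *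
      dir_deriv h (dir_deriv (0, axis j 1) (dir_deriv (0, axis i 1) energy)) (x, y))) (at (x, y))"
    by (intro has_derivative_vec_lambda has_derivative_mult_right has_derivative_dir_deriv
        diff_energy'' assms)
  show "(\<chi> i j. 1/2 * dir_deriv (0, axis j 1) (dir_deriv (0, axis i 1) energy) z) = tensor z"
    if "z \<in> V \<times> - {0}" for z
  proof (cases z)
    case (Pair a b)
    with that have "a \<in> V" "b \<noteq> 0" by auto
    then show ?thesis unfolding Pair
      by (intro vec_eq_iff[THEN iffD2] allI) (simp add: tensor_nth)
  qed
qed (use assms in simp)

lemma has_derivative_log_density:
  assumes "x \<in> V" "y \<noteq> 0"
  shows "(log_density has_derivative (\<lambda>h. dir_deriv
     (\<chi> i j. 1/2 * dir_deriv h (dir_deriv (0, axis j 1) (dir_deriv (0, axis i 1) energy)) (x, y))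
      det (tensor (x, y)) / (2 * det (tensor (x, y))))) (at (x, y))"
proof -
  have p: "det (tensor (x, y)) > 0" by (rule det_tensor_pos[OF assms])
  have 1: "((\<lambda>d. ln (sqrt d)) has_real_derivative inverse (2 * det (tensor (x, y)))) (at (det (tensor (x, y))))"
    using p by (auto intro!: derivative_eq_intros simp: field_simps)
  have 2: "((\<lambda>z. det (tensor z)) has_derivative (\<lambda>h. dir_deriv
     (\<chi> i j. 1/2 * dir_deriv h (dir_deriv (0, axis j 1) (dir_deriv (0, axis i 1) energy)) (x, y))
      det (tensor (x, y)))) (at (x, y))"
    using diff_chain_at[OF has_derivative_tensor[OF assms]
        has_derivative_dir_deriv[OF det_differentiable]]
    by (simp add: o_def)
  show ?thesis
    using diff_chain_at[OF 2 1[unfolded has_field_derivative_def]]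
    by (simp add: o_def log_density_def[abs_def] field_simps)
qed

lemma diff_log_density: "x \<in> V \<Longrightarrow> y \<noteq> 0 \<Longrightarrow> log_density differentiable (at (x, y))"
  using has_derivative_log_density by (auto simp: differentiable_def)

lemma transpose_mult_nth:
  "(transpose L ** G) $ i $ j = (L *v axis i 1) \<bullet> (G *v axis j (1::real))"
  "(G ** L) $ i $ j = axis i 1 \<bullet> (G *v (L *v axis j (1::real)))" for G L :: "real^'n^'n"
  unfolding matrix_vector_mult_basis inner_axis'
  by (simp_all add: matrix_matrix_mult_def matrix_vector_mult_def column_def inner_vec_def
      transpose_def)

text \<open>The vector \<open>(w, L y)\<close> is the complete lift at \<open>(x, y)\<close> of a vector field with value \<open>w\<close> and
  derivative \<open>L\<close> at \<open>x\<close>. Differentiating the invariance of the energy twice along the fibre, and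
  each time paying the extra term of \<open>dir_deriv_complete_lift\<close>, shows that \<open>g\<close> changes at the rate
  \<open>- (L\<^sup>T g + g L)\<close>; so \<open>ln (det g)\<close> changes at the rate of minus twice the trace of \<open>L\<close>.\<close>

lemma tensor_invariant:
  assumes inv: "\<And>y. y \<noteq> 0 \<Longrightarrow> dir_deriv (w, L *v y) energy (x, y) = 0"
    and x: "x \<in> V" and y: "y \<noteq> 0"
  shows dir_deriv_energy_invariant: "dir_deriv (w, L *v y) (dir_deriv (0, a) energy) (x, y) =
      - dir_deriv (0, L *v a) energy (x, y)" (is ?first)
    and log_density_invariant: "dir_deriv (w, L *v y) log_density (x, y) = - det_rate L" (is ?log)
proof -
  have first: "dir_deriv (w, L *v y) (dir_deriv (0, a) energy) (x, y) =
      - dir_deriv (0, L *v a) energy (x, y)" if "y \<noteq> 0" for a y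
  proof -
    have "dir_deriv a (\<lambda>y. dir_deriv (w, L *v y) energy (x, y)) y = dir_deriv a (\<lambda>y. 0) y"
      using inv that by (intro dir_deriv_cong_open[of "- {0}"]) auto
    also have "\<dots> = 0" by (simp add: dir_deriv_def)
    finally show ?thesis using dir_deriv_complete_lift[OF smooth_energy x that, of a w L] by simp
  qed
  then show ?first using y .
  have second: "dir_deriv (w, L *v y) (dir_deriv (0, b) (dir_deriv (0, a) energy)) (x, y) =
      - dir_deriv (0, b) (dir_deriv (0, L *v a) energy) (x, y)
      - dir_deriv (0, L *v b) (dir_deriv (0, a) energy) (x, y)" for a b
  proof -
    have d: "((\<lambda>y. - dir_deriv (0, L *v a) energy (x, y)) has_derivative
        (\<lambda>b. - dir_deriv (0, b) (dir_deriv (0, L *v a) energy) (x, y))) (at y)"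
      using has_derivative_minus[OF has_derivative_dir_deriv[OF
            differentiable_snd_var[OF diff_energy'[OF x y]]]]
      by (simp add: dir_deriv_snd_var[OF diff_energy'[OF x y]])
    have "dir_deriv b (\<lambda>y. dir_deriv (w, L *v y) (dir_deriv (0, a) energy) (x, y)) y =
        dir_deriv b (\<lambda>y. - dir_deriv (0, L *v a) energy (x, y)) y"
      using first y d by (intro dir_deriv_cong_open[of "- {0}"]) (auto simp: differentiable_def)
    also have "\<dots> = - dir_deriv (0, b) (dir_deriv (0, L *v a) energy) (x, y)"
      by (rule dir_deriv_eqI[OF d])
    finally show ?thesis
      using dir_deriv_complete_lift[OF smooth_on_dir_deriv[OF smooth_energy] x y, of b w L "(0, a)"]
      by simp
  qed
  let ?G = "tensor (x, y)"
  have "(\<chi> i j. 1/2 * dir_deriv (w, L *v y)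
      (dir_deriv (0, axis j 1) (dir_deriv (0, axis i 1) energy)) (x, y)) =
      - (transpose L ** ?G + ?G ** L)"
  proof (intro vec_eq_iff[THEN iffD2] allI)
    fix i j
    have "(transpose L ** ?G) $ i $ j =
        1/2 * dir_deriv (0, axis j 1) (dir_deriv (0, L *v axis i 1) energy) (x, y)"
      "(?G ** L) $ i $ j =
        1/2 * dir_deriv (0, L *v axis j 1) (dir_deriv (0, axis i 1) energy) (x, y)"
      unfolding transpose_mult_nth(1) transpose_mult_nth(2)[of ?G L]
      by (simp_all add: tensor_bilinear[OF x y])
    then show "(\<chi> i j. 1/2 * dir_deriv (w, L *v y)
        (dir_deriv (0, axis j 1) (dir_deriv (0, axis i 1) energy)) (x, y)) $ i $ j =
        (- (transpose L ** ?G + ?G ** L)) $ i $ j"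
      by (simp add: second)
  qed
  moreover have "dir_deriv (- (transpose L ** ?G + ?G ** L)) det ?G = - (2 * det_rate L * det ?G)"
    by (simp add: linear_neg[OF linear_dir_deriv[OF det_differentiable]]
        linear_diff[OF linear_dir_deriv[OF det_differentiable]]
        dir_deriv_det_mult_left dir_deriv_det_mult_right det_rate_transpose)
  ultimately show ?log
    using dir_deriv_eqI[OF has_derivative_log_density[OF x y], of "(w, L *v y)"]
      det_tensor_pos[OF x y] by simp
qed

text \<open>The columns of \<open>P\<close> are a basis of the tangent space. A linear change of fibre coordinates
  multiplies \<open>det g\<close> by the constant \<open>(det P)\<^sup>2\<close>, so the mean Cartan torsion, a logarithmic
  derivative, transforms as a covector.\<close>

lemma frame_coordinates:
  assumes x: "x \<in> V" and P: "det P \<noteq> 0" and u: "u \<noteq> 0"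
  defines "\<Phi> \<equiv> \<lambda>z. H x (P *v z)"
  shows frame_partial_deriv: "partial_deriv k (\<lambda>z. (\<Phi> z)\<^sup>2) u =
      dir_deriv (0, P *v axis k 1) energy (x, P *v u)"
    and frame_tensor: "fundamental_tensor \<Phi> u = transpose P ** tensor (x, P *v u) ** P"
    and frame_mean_cartan: "mean_cartan_coeff \<Phi> i u =
      dir_deriv (0, P *v axis i 1) log_density (x, P *v u)"
proof -
  have inj: "P *v z \<noteq> 0" if "z \<noteq> 0" for z
    using P that unfolding invertible_det_nz[symmetric] invertible_left_inverse
      matrix_left_invertible_ker by blast
  have lin: "((\<lambda>z. (x, P *v z)) has_derivative (\<lambda>h. (0, P *v h))) (at z)" for z
    by (intro has_derivative_Pair has_derivative_const bounded_linear_imp_has_derivative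
        matrix_vector_mul_bounded_linear)
  have chain: "partial_deriv k (\<lambda>z. f (x, P *v z)) z =
      dir_deriv (0, P *v axis k 1) f (x, P *v z)"
    if "f differentiable (at (x, P *v z))" for f :: "(real^'n) \<times> (real^'n) \<Rightarrow> real" and z k
  proof -
    have "(\<lambda>z. f (x, P *v z)) differentiable (at z)"
      using diff_chain_at[OF lin has_derivative_dir_deriv[OF that]]
      by (auto simp: differentiable_def o_def)
    from partial_deriv_eq_dir_deriv[OF this] dir_deriv_chain[OF lin that] show ?thesis by simp
  qed
  have first: "partial_deriv k (\<lambda>z. (\<Phi> z)\<^sup>2) z = dir_deriv (0, P *v axis k 1) energy (x, P *v z)"
    if "z \<noteq> 0" for z k
    using chain[OF diff_energy[OF x inj[OF that]]] by (simp add: \<Phi>_def energy_def)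
  from this[OF u] show "partial_deriv k (\<lambda>z. (\<Phi> z)\<^sup>2) u =
      dir_deriv (0, P *v axis k 1) energy (x, P *v u)" .
  have second: "fundamental_tensor \<Phi> z = transpose P ** tensor (x, P *v z) ** P"
    if "z \<noteq> 0" for z
  proof -
    have "partial_deriv j (partial_deriv i (\<lambda>z. (\<Phi> z)\<^sup>2)) z =
      dir_deriv (0, P *v axis j 1) (dir_deriv (0, P *v axis i 1) energy) (x, P *v z)" for i j
    proof -
      have "partial_deriv j (partial_deriv i (\<lambda>z. (\<Phi> z)\<^sup>2)) z =
          partial_deriv j (\<lambda>z. dir_deriv (0, P *v axis i 1) energy (x, P *v z)) z"
        using first that by (intro partial_deriv_cong_open[of "- {0}"]) auto
      then show ?thesis using chain[OF diff_energy'[OF x inj[OF that]]] by simp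
    qed
    then show ?thesis
      by (simp add: vec_eq_iff fundamental_tensor_def matrix_mul_assoc[symmetric]
          transpose_mult_nth(1) matrix_vector_mul_assoc[symmetric] tensor_bilinear[OF x inj[OF that]])
  qed
  from this[OF u] show "fundamental_tensor \<Phi> u = transpose P ** tensor (x, P *v u) ** P" .
  have "ln (sqrt (det (fundamental_tensor \<Phi> z))) = ln \<bar>det P\<bar> + log_density (x, P *v z)"
    if "z \<noteq> 0" for z
  proof -
    have "det (fundamental_tensor \<Phi> z) = (det P)\<^sup>2 * det (tensor (x, P *v z))"
      by (simp add: second[OF that] det_mul power2_eq_square)
    then show ?thesis
      using P det_tensor_pos[OF x inj[OF that]]
      by (simp add: log_density_def real_sqrt_mult ln_mult)
  qed
  then have "mean_cartan_coeff \<Phi> i u =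
      partial_deriv i (\<lambda>z. ln \<bar>det P\<bar> + log_density (x, P *v z)) u"
    unfolding mean_cartan_coeff_def using u
    by (intro partial_deriv_cong_open[of "- {0}"]) auto
  also have "\<dots> = dir_deriv (0, P *v axis i 1) (\<lambda>z. ln \<bar>det P\<bar> + log_density z) (x, P *v u)"
    by (rule chain) (intro differentiable_add differentiable_const diff_log_density x inj u)
  also have "\<dots> = dir_deriv (0, P *v axis i 1) log_density (x, P *v u)"
  proof -
    have "((\<lambda>z. ln \<bar>det P\<bar> + log_density z) has_derivative
        (\<lambda>v. 0 + dir_deriv v log_density (x, P *v u))) (at (x, P *v u))"
      by (intro has_derivative_add has_derivative_const has_derivative_dir_deriv
          diff_log_density x inj u)
    from dir_deriv_eqI[OF this] show ?thesis by simp
  qed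
  finally show "mean_cartan_coeff \<Phi> i u = dir_deriv (0, P *v axis i 1) log_density (x, P *v u)" .
qed

end


section \<open>The volume of the unit ball of the norm\<close>

lemma (in finsler_chart) smooth_H_continuous:
  "continuous_on (V \<times> (- {0})) (\<lambda>z. H (fst z) (snd z))"
  using smooth_on_continuous[OF smooth_H] by (simp add: case_prod_unfold)

lemma (in finsler_chart) continuous_on_H:
  assumes "x \<in> V"
  shows "continuous_on (- {0}) (H x)"
proof -
  have "continuous_on (- {0}) (\<lambda>y :: real^'n. (x, y))" by (intro continuous_intros)
  from continuous_on_compose2[OF smooth_H_continuous this] assms show ?thesis by auto
qed

lemma (in finsler_chart) unit_sphere_bounds:
  assumes x: "x \<in> V"
  obtains m M where "0 < m" "0 < M" "\<And>y. y \<in> sphere 0 1 \<Longrightarrow> m \<le> H x y"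
    "\<And>y. y \<in> sphere 0 1 \<Longrightarrow> H x y \<le> M"
proof -
  have c: "continuous_on (sphere 0 1) (H x)"
    by (rule continuous_on_subset[OF continuous_on_H[OF x]]) auto
  have ne: "sphere (0 :: real^'n) 1 \<noteq> {}" by simp
  obtain a where a: "a \<in> sphere 0 1" "\<And>y. y \<in> sphere 0 1 \<Longrightarrow> H x a \<le> H x y"
    using continuous_attains_inf[OF compact_sphere ne c] by blast
  obtain b where b: "b \<in> sphere 0 1" "\<And>y. y \<in> sphere 0 1 \<Longrightarrow> H x y \<le> H x b"
    using continuous_attains_sup[OF compact_sphere ne c] by blast
  have "a \<noteq> 0" "b \<noteq> 0" using a(1) b(1) by auto
  then show ?thesis
    using a b pos[OF x] by (intro that[of "H x a" "H x b"]) auto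
qed

lemma (in finsler_chart) H_radial:
  assumes "x \<in> V" "y \<noteq> 0"
  shows "H x y = norm y * H x (y /\<^sub>R norm y)"
  using homogeneous[OF assms(1), of "y /\<^sub>R norm y" "norm y"] assms(2) by simp

definition (in finsler_chart) unit_body :: "real^'n \<Rightarrow> (real^'n) set" where
  "unit_body x = {z. z = 0 \<or> H x z < 1}"

definition (in finsler_chart) body_volume :: "real^'n \<Rightarrow> real" where
  "body_volume x = measure lebesgue (unit_body x)"

lemma (in finsler_chart)
  assumes x: "x \<in> V"
  shows lmeasurable_unit_body: "unit_body x \<in> lmeasurable"
    and body_volume_pos: "body_volume x > 0"
proof -
  obtain m M where mM: "0 < m" "0 < M" "\<And>y. y \<in> sphere 0 1 \<Longrightarrow> m \<le> H x y"
    "\<And>y. y \<in> sphere 0 1 \<Longrightarrow> H x y \<le> M"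
    using unit_sphere_bounds[OF x] by blast
  have low: "m * norm y \<le> H x y" and high: "H x y \<le> M * norm y" if "y \<noteq> 0" for y
    using mM(3,4)[of "y /\<^sub>R norm y"] that H_radial[OF x that] by (simp_all add: field_simps)
  have "bounded (unit_body x)"
    unfolding bounded_iff unit_body_def
  proof (intro exI ballI)
    fix y assume y: "y \<in> {z. z = 0 \<or> H x z < 1}"
    show "norm y \<le> 1 / m"
    proof (cases "y = 0")
      case False
      with y low[OF False] have "m * norm y \<le> 1" by auto
      then show ?thesis using mM(1) by (simp add: field_simps)
    qed (use mM in simp)
  qed
  moreover have "unit_body x \<in> sets lebesgue"
  proof -
    have "open ((- {0}) \<inter> H x -` {..<1})"
      by (intro continuous_open_preimage continuous_on_H x) auto
    then have "(- {0}) \<inter> H x -` {..<1} \<in> sets lebesgue" by simp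
    moreover have "unit_body x = {0} \<union> ((- {0}) \<inter> H x -` {..<1})"
      by (auto simp: unit_body_def)
    ultimately show ?thesis by (metis closed_singleton lebesgue_closedin sets.Un lborelD borel_closed
          sets_completionI_sets sets_lborel)
  qed
  ultimately show *: "unit_body x \<in> lmeasurable" by (rule bounded_set_imp_lmeasurable)
  have "ball 0 (1 / M) \<subseteq> unit_body x"
  proof
    fix y :: "real^'n" assume y: "y \<in> ball 0 (1 / M)"
    show "y \<in> unit_body x"
    proof (cases "y = 0")
      case False
      have "M * norm y < 1" using y mM(2) by (simp add: field_simps)
      with high[OF False] show ?thesis by (simp add: unit_body_def)
    qed (simp add: unit_body_def)
  qed
  then have "measure lebesgue (ball (0 :: real^'n) (1 / M)) \<le> body_volume x"
    unfolding body_volume_def by (intro measure_mono_fmeasurable *) auto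
  moreover have "measure lebesgue (ball (0 :: real^'n) (1 / M)) > 0"
    using mM(2) by simp
  ultimately show "body_volume x > 0" by linarith
qed

text \<open>By invariance, the derivative of \<open>t \<mapsto> H (x + t w) (y + t L y)\<close> vanishes at \<open>t = 0\<close>, so the maps
  \<open>1 + t L\<close> between the tangent spaces along the line \<open>x + t w\<close> are isometries up to \<open>o(t)\<close>. The
  error is uniform in \<open>y\<close> because the unit sphere is compact and the norms are homogeneous.\<close>

lemma (in finsler_chart) almost_isometry:
  assumes inv: "\<And>y. y \<noteq> 0 \<Longrightarrow> dir_deriv (w, L *v y) (\<lambda>(x, y). H x y) (x, y) = 0"
    and x: "x \<in> V" and e: "e > 0"
  obtains d where "d > 0" "\<And>t. \<bar>t\<bar> < d \<Longrightarrow> x + t *\<^sub>R w \<in> V"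
    "\<And>t y. \<bar>t\<bar> < d \<Longrightarrow> y \<noteq> 0 \<Longrightarrow> (mat 1 + t *\<^sub>R L) *v y \<noteq> 0"
    "\<And>t y. \<bar>t\<bar> < d \<Longrightarrow> y \<noteq> 0 \<Longrightarrow>
      \<bar>H (x + t *\<^sub>R w) ((mat 1 + t *\<^sub>R L) *v y) - H x y\<bar> \<le> e * \<bar>t\<bar> * H x y"
proof -
  let ?f = "\<lambda>(x, y). H x y"
  define c where "c p = (x, snd p) + fst p *\<^sub>R (w, L *v snd p)" for p :: "real \<times> (real^'n)"
  have c_eq: "c (t, y) = (x + t *\<^sub>R w, (mat 1 + t *\<^sub>R L) *v y)" for t y
    by (simp add: c_def matrix_vector_mult_add_rdistrib scaleR_matrix_vector_assoc)
  define q where "q p = dir_deriv (w, L *v snd p) ?f (c p)" for p :: "real \<times> (real^'n)"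
  obtain m M where mM: "0 < m" "0 < M" "\<And>y. y \<in> sphere 0 1 \<Longrightarrow> m \<le> H x y"
    "\<And>y. y \<in> sphere 0 1 \<Longrightarrow> H x y \<le> M"
    using unit_sphere_bounds[OF x] by blast
  note m = mM(1,3)
  have cont_L: "continuous_on S (\<lambda>p. L *v snd p)" for S :: "(real \<times> (real^'n)) set"
    by (intro bounded_linear.continuous_on[OF matrix_vector_mul_bounded_linear] continuous_intros)
  have cont_c: "continuous_on S c" for S
    unfolding c_def[abs_def] by (intro continuous_intros cont_L)
  define D where "D = c -` (V \<times> (- {0}))"
  have open_D: "open D"
    unfolding D_def by (rule open_vimage[OF open_slit cont_c])
  have cont_q: "continuous_on D q"
  proof (rule continuous_on_eq)
    show "continuous_on D (\<lambda>p. dir_deriv (w, 0) ?f (c p) +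
        (\<Sum>i\<in>UNIV. (L *v snd p) $ i * dir_deriv (0, axis i 1) ?f (c p)))"
      using continuous_on_compose2[OF smooth_on_continuous[OF smooth_on_dir_deriv[OF smooth_H]] cont_c]
      by (intro continuous_intros cont_L) (auto simp: D_def)
    show "dir_deriv (w, 0) ?f (c p) +
        (\<Sum>i\<in>UNIV. (L *v snd p) $ i * dir_deriv (0, axis i 1) ?f (c p)) = q p" if "p \<in> D" for p
    proof -
      have d: "?f differentiable (at (c p))"
        using that by (intro smooth_on_differentiable[OF smooth_H]) (simp add: D_def)
      show ?thesis
        using dir_deriv_Pair_split[OF d, of w "L *v snd p"]
          linear_axis_expansion[OF linear_dir_deriv_snd[OF d], of "L *v snd p"]
        by (simp add: q_def)
    qed
  qed
  \<comment> \<open>\<open>q (t, y)\<close> is the derivative to be estimated. It vanishes for \<open>t = 0\<close>, hence is small on a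
    neighbourhood of \<open>{0}\<close> times the sphere, which contains a tube by compactness.\<close>
  define W where "W = D \<inter> q -` {- (e * m)<..<e * m}"
  have "open W"
    unfolding W_def by (intro continuous_open_preimage cont_q open_D) auto
  moreover have "{0} \<times> sphere 0 1 \<subseteq> W"
  proof clarify
    fix y :: "real^'n" assume "y \<in> sphere 0 1"
    then have y: "y \<noteq> 0" by auto
    then have "q (0, y) = 0" "c (0, y) = (x, y)" using inv by (simp_all add: q_def c_def)
    then show "(0, y) \<in> W" using x y m e by (simp add: W_def D_def)
  qed
  ultimately obtain d where d: "d > 0" "(\<Union>p\<in>{0} \<times> sphere 0 1. ball p d) \<subseteq> W"
    using compact_subset_open_imp_ball_epsilon_subset[of "{0} \<times> sphere (0 :: real^'n) 1" W]
    by (metis compact_Times compact_sphere compact_sing)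
  have inW: "(t, y) \<in> W" if "\<bar>t\<bar> < d" "y \<in> sphere 0 1" for t y
  proof -
    have "(t, y) \<in> ball (0, y) d" using that by (simp add: dist_Pair_Pair dist_real_def)
    then show ?thesis using d(2) that by blast
  qed
  have inD: "x + t *\<^sub>R w \<in> V" "(mat 1 + t *\<^sub>R L) *v y \<noteq> 0" if "\<bar>t\<bar> < d" "y \<in> sphere 0 1" for t y
    using inW[OF that] by (auto simp: W_def D_def c_eq)
  have unit: "\<bar>H (x + t *\<^sub>R w) ((mat 1 + t *\<^sub>R L) *v y) - H x y\<bar> \<le> e * \<bar>t\<bar> * H x y"
    if t: "\<bar>t\<bar> < d" and y: "y \<in> sphere 0 1" for t y
  proof -
    let ?h = "\<lambda>s. ?f ((x, y) + s *\<^sub>R (w, L *v y))"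
    have "norm (?h t - ?h 0) \<le> e * m * norm (t - 0)"
    proof (rule field_differentiable_bound)
      fix s assume "s \<in> {- d<..<d}"
      then have s: "(s, y) \<in> W" using inW[of s y] y by auto
      have "?f differentiable (at (c (s, y)))"
        using s by (intro smooth_on_differentiable[OF smooth_H]) (simp add: W_def D_def)
      then have "(?h has_real_derivative q (s, y)) (at s)"
        using dir_deriv_line[of ?f "(x, y)" s "(w, L *v y)"] by (simp add: c_def q_def)
      then show "(?h has_field_derivative q (s, y)) (at s within {- d<..<d})"
        by (rule has_field_derivative_at_within)
      show "norm (q (s, y)) \<le> e * m" using s by (auto simp: W_def)
    qed (use t d in auto)
    also have "e * m * norm (t - 0) = e * \<bar>t\<bar> * m" by simp
    also have "\<dots> \<le> e * \<bar>t\<bar> * H x y"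
      using m(2)[OF y] e by (intro mult_left_mono) auto
    finally have "\<bar>?f (c (t, y)) - H x y\<bar> \<le> e * \<bar>t\<bar> * H x y"
      by (simp add: c_def)
    then show ?thesis by (simp add: c_eq)
  qed
  show ?thesis
  proof (rule that[OF d(1)])
    show V: "x + t *\<^sub>R w \<in> V" if "\<bar>t\<bar> < d" for t
      \<comment> \<open>Any unit vector serves here.\<close>
      using inD(1)[OF that, of "axis undefined 1"] by simp
    fix t :: real and y :: "real^'n" assume t: "\<bar>t\<bar> < d" and y: "y \<noteq> 0"
    define z where "z = y /\<^sub>R norm y"
    have z: "z \<in> sphere 0 1" "y = norm y *\<^sub>R z" "z \<noteq> 0" using y by (auto simp: z_def)
    have Pz: "(mat 1 + t *\<^sub>R L) *v y = norm y *\<^sub>R ((mat 1 + t *\<^sub>R L) *v z)"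
      by (metis z(2) matrix_vector_mult_scaleR)
    then show "(mat 1 + t *\<^sub>R L) *v y \<noteq> 0" using inD(2)[OF t z(1)] y by simp
    have "H (x + t *\<^sub>R w) ((mat 1 + t *\<^sub>R L) *v y) =
        norm y * H (x + t *\<^sub>R w) ((mat 1 + t *\<^sub>R L) *v z)"
      unfolding Pz using y by (intro homogeneous V t inD(2) z) auto
    moreover have "H x y = norm y * H x z"
      using homogeneous[OF x z(3), of "norm y"] y z(2) by simp
    ultimately have "\<bar>H (x + t *\<^sub>R w) ((mat 1 + t *\<^sub>R L) *v y) - H x y\<bar> =
        norm y * \<bar>H (x + t *\<^sub>R w) ((mat 1 + t *\<^sub>R L) *v z) - H x z\<bar>"
      by (simp add: right_diff_distrib[symmetric] abs_mult)
    also have "\<dots> \<le> norm y * (e * \<bar>t\<bar> * H x z)"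
      by (intro mult_left_mono unit t z) auto
    also have "\<dots> = e * \<bar>t\<bar> * H x y" using \<open>H x y = norm y * H x z\<close> by simp
    finally show "\<bar>H (x + t *\<^sub>R w) ((mat 1 + t *\<^sub>R L) *v y) - H x y\<bar> \<le> e * \<bar>t\<bar> * H x y" .
  qed
qed

text \<open>The unit ball at \<open>x + t w\<close> lies between two multiples, by factors \<open>1 + o(t)\<close>, of the image under
  \<open>1 + t L\<close> of the unit ball at \<open>x\<close>; to first order its volume is therefore that of this image.\<close>

lemma (in finsler_chart) DERIV_body_volume:
  assumes inv: "\<And>y. y \<noteq> 0 \<Longrightarrow> dir_deriv (w, L *v y) (\<lambda>(x, y). H x y) (x, y) = 0"
    and x: "x \<in> V"
  shows "((\<lambda>t. body_volume (x + t *\<^sub>R w)) has_real_derivative det_rate L * body_volume x) (at 0)"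
proof -
  define P where "P t = mat 1 + t *\<^sub>R L" for t
  define \<delta> where "\<delta> t = det (P t) * body_volume x" for t
  let ?v = "body_volume x" and ?n = "CARD('n)"
  have v: "?v > 0" by (rule body_volume_pos[OF x])
  have \<delta>: "(\<delta> has_real_derivative det_rate L * ?v) (at 0)"
    unfolding \<delta>_def P_def by (intro DERIV_cmult_right DERIV_det_rate)
  have ev_det: "\<forall>\<^sub>F t in at 0. det (P t) \<in> {0<..<2}"
  proof -
    have "((\<lambda>t. det (P t)) \<longlongrightarrow> det (P 0)) (at 0)"
      using DERIV_isCont[OF DERIV_det_rate[of L]] unfolding P_def isCont_def .
    then show ?thesis by (rule topological_tendstoD) (auto simp: P_def)
  qed
  let ?r = "\<lambda>t. body_volume (x + t *\<^sub>R w) - \<delta> t"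
  have "((\<lambda>t. (?r (0 + t) - ?r 0) / t) \<longlongrightarrow> 0) (at 0)"
  proof (rule tendstoI)
    fix \<epsilon> :: real assume \<epsilon>: "\<epsilon> > 0"
    \<comment> \<open>The relative error of the volume is at most \<open>2 n e \<bar>t\<bar>\<close> provided \<open>n e \<le> 1/2\<close>, and the volume
      of the image is at most \<open>2 v\<close>.\<close>
    define e where "e = min (1 / (2 * ?n)) (\<epsilon> / (8 * ?n * ?v))"
    have n: "real ?n > 0" by simp
    have e: "e > 0" "?n * e \<le> 1/2" "4 * ?n * ?v * e < \<epsilon>"
    proof -
      show "e > 0" using \<epsilon> v n by (simp add: e_def)
      have "e \<le> 1 / (2 * ?n)" by (simp add: e_def)
      then show "?n * e \<le> 1/2" using n by (simp add: field_simps)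
      have "e \<le> \<epsilon> / (8 * ?n * ?v)" by (simp add: e_def)
      then have "8 * ?n * ?v * e \<le> \<epsilon>" using n v by (simp add: field_simps)
      moreover have "?n * ?v * e > 0" using n v \<open>e > 0\<close> by simp
      ultimately show "4 * ?n * ?v * e < \<epsilon>" by linarith
    qed
    obtain d where d: "d > 0" "\<And>t. \<bar>t\<bar> < d \<Longrightarrow> x + t *\<^sub>R w \<in> V"
      "\<And>t y. \<bar>t\<bar> < d \<Longrightarrow> y \<noteq> 0 \<Longrightarrow> P t *v y \<noteq> 0"
      "\<And>t y. \<bar>t\<bar> < d \<Longrightarrow> y \<noteq> 0 \<Longrightarrow>
        \<bar>H (x + t *\<^sub>R w) (P t *v y) - H x y\<bar> \<le> e * \<bar>t\<bar> * H x y"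
      using almost_isometry[OF inv x e(1)] unfolding P_def by blast
    have "\<forall>\<^sub>F t in at 0. \<bar>t\<bar> < min d 1 \<and> t \<noteq> 0"
      unfolding eventually_at using d(1) by (intro exI[of _ "min d 1"]) auto
    then show "\<forall>\<^sub>F t in at 0. dist ((?r (0 + t) - ?r 0) / t) 0 < \<epsilon>"
      using ev_det
    proof eventually_elim
      case (elim t)
      define a where "a = e * \<bar>t\<bar>"
      let ?x' = "x + t *\<^sub>R w" and ?p = "det (P t)"
      have t: "\<bar>t\<bar> < d" "\<bar>t\<bar> < 1" "t \<noteq> 0" and p: "0 < ?p" "?p < 2" using elim by auto
      have na: "?n * a \<le> 1/2"
      proof -
        have "?n * e * \<bar>t\<bar> \<le> (1/2) * 1" using e t by (intro mult_mono) auto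
        then show ?thesis by (simp add: a_def)
      qed
      have a: "0 < a" "a < 1"
      proof -
        show "0 < a" using e t by (simp add: a_def)
        have "1 * a \<le> ?n * a" using \<open>0 < a\<close> by (intro mult_right_mono) auto
        with na show "a < 1" by simp
      qed
      have H': "(1 - a) * H x y \<le> H ?x' (P t *v y)" "H ?x' (P t *v y) \<le> (1 + a) * H x y"
        if "y \<noteq> 0" for y
        using d(4)[OF t(1) that] by (auto simp: a_def abs_le_iff algebra_simps)
      have x': "?x' \<in> V" by (rule d(2)[OF t(1)])
      have "(\<lambda>y. (1 / (1 + a)) *\<^sub>R (P t *v y)) ` unit_body x \<subseteq> unit_body ?x'"
      proof clarify
        fix y assume y: "y \<in> unit_body x"
        show "(1 / (1 + a)) *\<^sub>R (P t *v y) \<in> unit_body ?x'"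
        proof (cases "y = 0")
          case False
          have "H ?x' ((1 / (1 + a)) *\<^sub>R (P t *v y)) = (1 / (1 + a)) * H ?x' (P t *v y)"
            using a by (intro homogeneous x' d(3) t False) auto
          also have "\<dots> \<le> H x y" using H'(2)[OF False] a by (simp add: field_simps)
          also have "\<dots> < 1" using y False by (simp add: unit_body_def)
          finally show ?thesis by (simp add: unit_body_def)
        qed (simp add: unit_body_def)
      qed
      from measure_mono_fmeasurable[OF this _ lmeasurable_unit_body[OF x']]
      have low: "(1 / (1 + a)) ^ ?n * \<delta> t \<le> body_volume ?x'"
        using lmeasurable_scaled_image[OF lmeasurable_unit_body[OF x], of "1 / (1 + a)" "P t"] a p
        unfolding measure_scaled_image[OF lmeasurable_unit_body[OF x]] \<delta>_def body_volume_def
        by (simp add: fmeasurableD mult.assoc)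
      have "unit_body ?x' \<subseteq> (\<lambda>y. (1 / (1 - a)) *\<^sub>R (P t *v y)) ` unit_body x"
      proof
        fix z assume z: "z \<in> unit_body ?x'"
        show "z \<in> (\<lambda>y. (1 / (1 - a)) *\<^sub>R (P t *v y)) ` unit_body x"
        proof (cases "z = 0")
          case True
          then show ?thesis by (intro image_eqI[of _ _ 0]) (auto simp: unit_body_def)
        next
          case False
          define y where "y = (1 - a) *\<^sub>R (matrix_inv (P t) *v z)"
          have Py: "P t *v y = (1 - a) *\<^sub>R z"
            using matrix_inv_mult(1)[of "P t"] p
            by (simp add: y_def matrix_vector_mult_scaleR matrix_vector_mul_assoc)
          then have y: "y \<noteq> 0" using False a by auto
          have "(1 - a) * H x y \<le> H ?x' (P t *v y)" by (rule H'(1)[OF y])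
          also have "\<dots> = (1 - a) * H ?x' z"
            unfolding Py using a by (intro homogeneous x' False) auto
          also have "\<dots> < (1 - a) * 1" using z False a by (simp add: unit_body_def)
          finally have "H x y < 1" using a by simp
          then show ?thesis using Py a by (intro image_eqI[of _ _ y]) (auto simp: unit_body_def)
        qed
      qed
      from measure_mono_fmeasurable[OF this _ lmeasurable_scaled_image[OF lmeasurable_unit_body[OF x]]]
      have high: "body_volume ?x' \<le> (1 / (1 - a)) ^ ?n * \<delta> t"
        using lmeasurable_unit_body[OF x'] a p
        unfolding measure_scaled_image[OF lmeasurable_unit_body[OF x]] \<delta>_def body_volume_def
        by (simp add: fmeasurableD mult.assoc)
      have \<delta>t: "0 < \<delta> t" "\<delta> t \<le> 2 * ?v" using p v by (auto simp: \<delta>_def)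
      have "1 - ?n * a \<le> (1 - a) ^ ?n"
        using Bernoulli_inequality[of "- a" ?n] a by simp
      also have "\<dots> \<le> (1 / (1 + a)) ^ ?n"
        using a by (intro power_mono) (auto simp: field_simps power2_eq_square)
      finally have b1: "1 - ?n * a \<le> (1 / (1 + a)) ^ ?n" .
      have "(1 / (1 - a)) ^ ?n = 1 / (1 - a) ^ ?n" by (simp add: power_one_over)
      also have "\<dots> \<le> 1 / (1 - ?n * a)"
        using \<open>1 - ?n * a \<le> (1 - a) ^ ?n\<close> na by (intro divide_left_mono) auto
      also have "\<dots> \<le> 1 + 2 * (?n * a)"
      proof -
        have "(?n * a) * (?n * a) \<le> (1/2) * (?n * a)" using na a by (intro mult_right_mono) auto
        then have "1 \<le> (1 + 2 * (?n * a)) * (1 - ?n * a)" by (simp add: algebra_simps)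
        then show ?thesis using na by (simp add: divide_le_eq)
      qed
      finally have b2: "(1 / (1 - a)) ^ ?n \<le> 1 + 2 * (?n * a)" .
      have "(1 - ?n * a) * \<delta> t \<le> body_volume ?x'"
        by (rule order_trans[OF mult_right_mono[OF b1] low]) (use \<delta>t in simp)
      moreover have "body_volume ?x' \<le> (1 + 2 * (?n * a)) * \<delta> t"
        by (rule order_trans[OF high mult_right_mono[OF b2]]) (use \<delta>t in simp)
      moreover have "0 \<le> (?n * a) * \<delta> t" using a \<delta>t by simp
      ultimately have "\<bar>?r t\<bar> \<le> 2 * (?n * a) * \<delta> t"
        by (simp add: abs_le_iff algebra_simps)
      also have "\<dots> \<le> 2 * (?n * a) * (2 * ?v)"
        using a \<delta>t by (intro mult_left_mono) auto
      also have "\<dots> = 4 * ?n * ?v * e * \<bar>t\<bar>" by (simp add: a_def)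
      also have "\<dots> < \<epsilon> * \<bar>t\<bar>" using e(3) t by (intro mult_strict_right_mono) auto
      finally have "\<bar>?r t\<bar> / \<bar>t\<bar> < \<epsilon>" using t by (simp add: divide_less_eq)
      moreover have "?r 0 = 0" by (simp add: \<delta>_def P_def)
      ultimately show ?case by (simp add: dist_real_def abs_divide)
    qed
  qed
  then have "(?r has_real_derivative 0) (at 0)" unfolding DERIV_def .
  from DERIV_add[OF this \<delta>] show ?thesis by simp
qed

lemma (in finsler_chart) distortion_eq:
  assumes "x \<in> V" "y \<noteq> 0"
  shows "distortion H x y = log_density (x, y) + ln (body_volume x) -
    ln (measure lebesgue (ball (0 :: real^'n) 1))"
  using det_tensor_pos[OF assms] body_volume_pos[OF assms(1)]
  by (simp add: distortion_def Let_def log_density_def tensor_def ln_mult ln_div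
      unit_body_def[symmetric] body_volume_def[symmetric])

lemma (in finsler_chart) partial_deriv_distortion_fibre:
  assumes x: "x \<in> V" and y: "y \<noteq> 0"
  shows "partial_deriv i (distortion H x) y = dir_deriv (0, axis i 1) log_density (x, y)"
proof -
  let ?k = "ln (body_volume x) - ln (measure lebesgue (ball (0 :: real^'n) 1))"
  have d: "((\<lambda>y. log_density (x, y) + ?k) has_derivative
      (\<lambda>v. dir_deriv v (\<lambda>y. log_density (x, y)) y + 0)) (at y)"
    by (intro has_derivative_add has_derivative_const has_derivative_dir_deriv
        differentiable_snd_var diff_log_density x y)
  have "partial_deriv i (distortion H x) y = partial_deriv i (\<lambda>y. log_density (x, y) + ?k) y"
    using x y distortion_eq by (intro partial_deriv_cong_open[of "- {0}"]) auto
  also have "\<dots> = dir_deriv (axis i 1) (\<lambda>y. log_density (x, y) + ?k) y"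
    using d by (intro partial_deriv_eq_dir_deriv) (auto simp: differentiable_def)
  also have "\<dots> = dir_deriv (0, axis i 1) log_density (x, y)"
    unfolding dir_deriv_eqI[OF d] by (simp add: dir_deriv_snd_var diff_log_density x y)
  finally show ?thesis .
qed

lemma (in finsler_chart) partial_deriv_distortion_base:
  assumes inv: "\<And>y. y \<noteq> 0 \<Longrightarrow> dir_deriv (axis i 1, L *v y) (\<lambda>(x, y). H x y) (x, y) = 0"
    and x: "x \<in> V" and y: "y \<noteq> 0"
  shows "partial_deriv i (\<lambda>x. distortion H x y) x =
    dir_deriv (axis i 1, 0) log_density (x, y) + det_rate L"
proof -
  let ?k = "ln (measure lebesgue (ball (0 :: real^'n) 1))"
  let ?c = "\<lambda>t. x + t *\<^sub>R axis i (1 :: real)"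
  have "((\<lambda>t. log_density (?c t, y)) has_real_derivative
      dir_deriv (axis i 1) (\<lambda>x. log_density (x, y)) x) (at 0)"
    using dir_deriv_line[of "\<lambda>x. log_density (x, y)" x 0 "axis i 1"]
      differentiable_fst_var[OF diff_log_density[OF x y]] by simp
  moreover have "((\<lambda>t. ln (body_volume (?c t))) has_real_derivative det_rate L) (at 0)"
    using DERIV_body_volume[OF inv x] body_volume_pos[OF x]
    by (auto intro!: derivative_eq_intros)
  ultimately have "((\<lambda>t. log_density (?c t, y) + ln (body_volume (?c t)) - ?k) has_real_derivative
      dir_deriv (axis i 1) (\<lambda>x. log_density (x, y)) x + det_rate L - 0) (at 0)"
    by (intro DERIV_add DERIV_diff DERIV_const)
  then have "partial_deriv i (\<lambda>x. log_density (x, y) + ln (body_volume x) - ?k) x =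
      dir_deriv (axis i 1) (\<lambda>x. log_density (x, y)) x + det_rate L - 0"
    unfolding partial_deriv_def by (rule DERIV_imp_deriv)
  moreover have "partial_deriv i (\<lambda>x. distortion H x y) x =
      partial_deriv i (\<lambda>x. log_density (x, y) + ln (body_volume x) - ?k) x"
    using x y distortion_eq by (intro partial_deriv_cong_open[OF open_V]) auto
  ultimately show ?thesis by (simp add: dir_deriv_fst_var diff_log_density x y)
qed


section \<open>The S-curvature in a chart\<close>

context finsler_chart
begin

lemma dir_deriv_energy:
  assumes "x \<in> V" "y \<noteq> 0"
  shows "dir_deriv v energy (x, y) = 2 * H x y * dir_deriv v (\<lambda>(x, y). H x y) (x, y)"
proof -
  have d: "(\<lambda>(x, y). H x y) differentiable (at (x, y))"
    by (rule diff_at[OF smooth_H assms])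
  have "((\<lambda>z. (case z of (x, y) \<Rightarrow> H x y)\<^sup>2) has_derivative
      (\<lambda>v. 2 * H x y * dir_deriv v (\<lambda>(x, y). H x y) (x, y))) (at (x, y))"
    using has_derivative_power[OF has_derivative_dir_deriv[OF d], of 2]
    by (simp add: algebra_simps)
  from dir_deriv_eqI[OF this] show ?thesis
    by (simp add: energy_def[abs_def] case_prod_unfold)
qed

text \<open>The columns of \<open>P\<close> are the values of the frame at \<open>x\<close>, the matrices \<open>B i\<close> its derivatives, and
  \<open>bracket\<close> says that \<open>C\<close> are its structure constants at \<open>x\<close>. Subtracting from the spray at
  \<open>\<eta> = P u\<close> the complete lift of the Killing field through \<open>\<eta>\<close>, which annihilates the distortion,
  leaves a vertical vector \<open>W\<close>; it remains to lower its index in the frame.\<close>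

lemma S_curvature_from_killing_frame:
  fixes B :: "'n \<Rightarrow> real^'n^'n" and C :: "'n \<Rightarrow> 'n \<Rightarrow> 'n \<Rightarrow> real"
  assumes x: "x \<in> V" and P: "det P \<noteq> 0" and u: "u \<noteq> 0"
    and killing: "\<And>i y. y \<noteq> 0 \<Longrightarrow>
      dir_deriv (P *v axis i 1, B i *v y) (\<lambda>(x, y). H x y) (x, y) = 0"
    and bracket: "\<And>l j. B j *v (P *v axis l 1) - B l *v (P *v axis j 1) = P *v (\<chi> k. C k l j)"
  defines "\<Phi> \<equiv> \<lambda>z. H x (P *v z)"
  shows "spray_apply H (distortion H) x (P *v u) =
    1/2 * (\<Sum>i\<in>UNIV. \<Sum>l\<in>UNIV. \<Sum>k\<in>UNIV. \<Sum>j\<in>UNIV.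
      matrix_inv (fundamental_tensor \<Phi> u) $ i $ l * C k l j *
      partial_deriv k (\<lambda>z. (\<Phi> z)\<^sup>2) u * u $ j * mean_cartan_coeff \<Phi> i u)"
proof -
  define \<eta> where "\<eta> = P *v u"
  define L where "L w = (\<Sum>j\<in>UNIV. (matrix_inv P *v w) $ j *\<^sub>R B j)" for w
  let ?f = "\<lambda>(x, y). H x y"
  let ?g = "tensor (x, \<eta>)"
  have PP: "P *v (matrix_inv P *v w) = w" "matrix_inv P *v (P *v w) = w" for w
    using matrix_inv_mult[OF P] by (simp_all add: matrix_vector_mul_assoc)
  have \<eta>: "\<eta> \<noteq> 0" using u PP(2)[of u] by (auto simp: \<eta>_def)
  have L_apply: "L w *v y = (\<Sum>j\<in>UNIV. (matrix_inv P *v w) $ j *\<^sub>R (B j *v y))" for w y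
    unfolding L_def
    by (induction rule: infinite_finite_induct[of _ "UNIV :: 'n set"])
       (auto simp: matrix_vector_mult_add_rdistrib scaleR_matrix_vector_assoc)
  have linear_L: "linear L"
    by (rule linearI) (simp_all add: L_def matrix_vector_right_distrib scaleR_add_left
        sum.distrib matrix_vector_mult_scaleR scaleR_sum_right)
  \<comment> \<open>The combination of the frame with constant coefficients and value \<open>w\<close> at \<open>x\<close> is a Killing
    field, and \<open>L w\<close> is its derivative.\<close>
  have inv: "dir_deriv (w, L w *v y) ?f (x, y) = 0" if y: "y \<noteq> 0" for w y
  proof -
    let ?a = "matrix_inv P *v w"
    note lin = linear_dir_deriv[OF diff_at[OF smooth_H x y]]
    have "w = (\<Sum>j\<in>UNIV. ?a $ j *\<^sub>R (P *v axis j 1))"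
      using linear_axis_expansion[OF matrix_vector_mul_linear[of P], of ?a] PP by simp
    then have "(w, L w *v y) = (\<Sum>j\<in>UNIV. ?a $ j *\<^sub>R (P *v axis j 1, B j *v y))"
      by (simp add: L_apply sum_prod prod_eq_iff fst_sum snd_sum)
    then show ?thesis
      by (simp add: linear_sum[OF lin] linear_cmul[OF lin] killing[OF y] o_def del: scaleR_Pair)
  qed
  then have inv_energy: "dir_deriv (w, L w *v y) energy (x, y) = 0" if "y \<noteq> 0" for w y
    using that by (simp add: dir_deriv_energy[OF x])
  define Z where "Z = (\<chi> l. (\<Sum>j\<in>UNIV. partial_deriv l (\<lambda>y'. partial_deriv j
      (\<lambda>x'. (H x' y')\<^sup>2) x) \<eta> * \<eta> $ j) - partial_deriv l (\<lambda>x'. (H x' \<eta>)\<^sup>2) x)"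
  define N where "N = - (1/2) *\<^sub>R (matrix_inv ?g *v Z)"
  define W where "W = N - L \<eta> *v \<eta>"
  have S: "spray_apply H (distortion H) x \<eta> = dir_deriv (0, W) log_density (x, \<eta>)"
  proof -
    note d = diff_log_density[OF x \<eta>]
    note exp = linear_axis_expansion[OF linear_dir_deriv_fst[OF d]]
      linear_axis_expansion[OF linear_dir_deriv_snd[OF d]]
    have "(\<Sum>i\<in>UNIV. \<eta> $ i * partial_deriv i (\<lambda>x'. distortion H x' \<eta>) x) =
        dir_deriv (\<eta>, 0) log_density (x, \<eta>) + det_rate (L \<eta>)"
      using linear_axis_expansion[OF linear_compose[OF linear_L linear_det_rate], of \<eta>]
      by (simp add: partial_deriv_distortion_base[OF inv x \<eta>] exp(1)[of \<eta>] algebra_simps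
          sum.distrib)
    moreover have "- (1/2 * (\<Sum>i\<in>UNIV. \<Sum>l\<in>UNIV. matrix_inv ?g $ i $ l * Z $ l *
        partial_deriv i (distortion H x) \<eta>)) = dir_deriv (0, N) log_density (x, \<eta>)"
      unfolding exp(2)[of N]
      by (simp add: partial_deriv_distortion_fibre[OF x \<eta>] N_def matrix_vector_mult_def
          sum_distrib_right sum_distrib_left sum_negf algebra_simps)
    ultimately have "spray_apply H (distortion H) x \<eta> =
        dir_deriv (\<eta>, 0) log_density (x, \<eta>) + det_rate (L \<eta>) + dir_deriv (0, N) log_density (x, \<eta>)"
      unfolding spray_apply_def by (simp add: Z_def tensor_def)
    also have "\<dots> = dir_deriv (\<eta>, L \<eta> *v \<eta>) log_density (x, \<eta>) + det_rate (L \<eta>) +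
        dir_deriv (0, W) log_density (x, \<eta>)"
      using dir_deriv_Pair_split[OF d, of \<eta> "L \<eta> *v \<eta>"]
        linear_diff[OF linear_dir_deriv_snd[OF d], of N "L \<eta> *v \<eta>"]
      by (simp add: W_def)
    also have "\<dots> = dir_deriv (0, W) log_density (x, \<eta>)"
      using log_density_invariant[OF inv_energy x \<eta>] by simp
    finally show ?thesis .
  qed
  \<comment> \<open>The mixed derivative in the spray is eliminated by the fibre derivative of the Killing
    equation for \<open>\<eta>\<close>.\<close>
  have Z: "Z $ l = - dir_deriv (0, L \<eta> *v axis l 1) energy (x, \<eta>)
      - 2 * (?g *v (L \<eta> *v \<eta>)) $ l - dir_deriv (axis l 1, 0) energy (x, \<eta>)" for l
  proof -
    note d = diff_energy'[OF x \<eta>, of "(0, axis l 1)"]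
    have "partial_deriv l (\<lambda>y'. partial_deriv j (\<lambda>x'. (H x' y')\<^sup>2) x) \<eta> =
        dir_deriv (axis j 1, 0) (dir_deriv (0, axis l 1) energy) (x, \<eta>)" for j
    proof -
      have "partial_deriv l (\<lambda>y'. partial_deriv j (\<lambda>x'. (H x' y')\<^sup>2) x) \<eta> =
          partial_deriv l (\<lambda>y'. dir_deriv (axis j 1, 0) energy (x, y')) \<eta>"
        using x \<eta> by (intro partial_deriv_cong_open[of "- {0}"] partial_deriv_energy) auto
      also have "\<dots> = dir_deriv (0, axis l 1) (dir_deriv (axis j 1, 0) energy) (x, \<eta>)"
        by (simp add: partial_deriv_eq_dir_deriv[OF differentiable_snd_var] dir_deriv_snd_var
            diff_energy'[OF x \<eta>])
      also have "\<dots> = dir_deriv (axis j 1, 0) (dir_deriv (0, axis l 1) energy) (x, \<eta>)"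
        by (rule commute_at[OF smooth_energy x \<eta>])
      finally show ?thesis .
    qed
    then have "(\<Sum>j\<in>UNIV. partial_deriv l (\<lambda>y'. partial_deriv j (\<lambda>x'. (H x' y')\<^sup>2) x) \<eta> * \<eta> $ j) =
        dir_deriv (\<eta>, 0) (dir_deriv (0, axis l 1) energy) (x, \<eta>)"
      using linear_axis_expansion[OF linear_dir_deriv_fst[OF d], of \<eta>]
      by (simp add: mult.commute)
    also have "\<dots> = dir_deriv (\<eta>, L \<eta> *v \<eta>) (dir_deriv (0, axis l 1) energy) (x, \<eta>) -
        dir_deriv (0, L \<eta> *v \<eta>) (dir_deriv (0, axis l 1) energy) (x, \<eta>)"
      using dir_deriv_Pair_split[OF d, of \<eta> "L \<eta> *v \<eta>"] by simp
    also have "dir_deriv (0, L \<eta> *v \<eta>) (dir_deriv (0, axis l 1) energy) (x, \<eta>) =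
        2 * (?g *v (L \<eta> *v \<eta>)) $ l"
      using tensor_bilinear[OF x \<eta>, of "axis l 1" "L \<eta> *v \<eta>"] by (simp add: inner_axis')
    also have "dir_deriv (\<eta>, L \<eta> *v \<eta>) (dir_deriv (0, axis l 1) energy) (x, \<eta>) =
        - dir_deriv (0, L \<eta> *v axis l 1) energy (x, \<eta>)"
      by (rule dir_deriv_energy_invariant[OF inv_energy x \<eta>])
    finally show ?thesis by (simp add: Z_def partial_deriv_energy(2)[OF x \<eta>])
  qed
  \<comment> \<open>The term \<open>L \<eta> \<eta>\<close> of \<open>W\<close> cancels the second derivatives that are left in \<open>Z\<close>.\<close>
  have gW: "w \<bullet> (?g *v W) = 1/2 * (dir_deriv (0, L \<eta> *v w) energy (x, \<eta>) +
      dir_deriv (w, 0) energy (x, \<eta>))" for w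
  proof -
    note d = diff_energy[OF x \<eta>]
    have "?g *v (matrix_inv ?g *v Z) = Z"
      using matrix_inv_mult(1)[of ?g] det_tensor_pos[OF x \<eta>] by (simp add: matrix_vector_mul_assoc)
    then have gW: "?g *v W = - (1/2) *\<^sub>R Z - ?g *v (L \<eta> *v \<eta>)"
      unfolding W_def N_def
      by (simp only: matrix_vector_mult_diff_distrib matrix_vector_mult_scaleR)
    have "(?g *v W) $ l = 1/2 * (dir_deriv (0, L \<eta> *v axis l 1) energy (x, \<eta>) +
        dir_deriv (axis l 1, 0) energy (x, \<eta>))" for l
    proof -
      have "(?g *v W) $ l = - (1/2) * Z $ l - (?g *v (L \<eta> *v \<eta>)) $ l" by (simp add: gW)
      then show ?thesis by (simp add: Z add_divide_distrib diff_divide_distrib algebra_simps)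
    qed
    moreover have "dir_deriv (0, L \<eta> *v w) energy (x, \<eta>) =
        (\<Sum>l\<in>UNIV. w $ l * dir_deriv (0, L \<eta> *v axis l 1) energy (x, \<eta>))"
      using linear_axis_expansion[OF linear_compose[OF matrix_vector_mul_linear[of "L \<eta>"]
            linear_dir_deriv_snd[OF d]], of w] by simp
    moreover have "dir_deriv (w, 0) energy (x, \<eta>) =
        (\<Sum>l\<in>UNIV. w $ l * dir_deriv (axis l 1, 0) energy (x, \<eta>))"
      using linear_axis_expansion[OF linear_dir_deriv_fst[OF d], of w] by simp
    ultimately show ?thesis
      by (simp add: inner_vec_def sum_distrib_left sum.distrib algebra_simps
          flip: sum_divide_distrib)
  qed
  define c where "c = (\<chi> l. 1/2 * (\<Sum>k\<in>UNIV. \<Sum>j\<in>UNIV. C k l j *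
      dir_deriv (0, P *v axis k 1) energy (x, \<eta>) * u $ j))"
  \<comment> \<open>The Killing equation of the frame field itself trades the derivative of the energy along the
    base for one along the fibre, and a Lie bracket appears.\<close>
  have c: "(P *v axis l 1) \<bullet> (?g *v W) = c $ l" for l
  proof -
    let ?\<xi> = "P *v axis l 1"
    note lin = linear_dir_deriv_snd[OF diff_energy[OF x \<eta>]]
    have "dir_deriv (?\<xi>, B l *v \<eta>) energy (x, \<eta>) = 0"
      using killing[OF \<eta>] by (simp add: dir_deriv_energy[OF x \<eta>])
    then have "dir_deriv (?\<xi>, 0) energy (x, \<eta>) = - dir_deriv (0, B l *v \<eta>) energy (x, \<eta>)"
      using dir_deriv_Pair_split[OF diff_energy[OF x \<eta>], of ?\<xi> "B l *v \<eta>"] by simp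
    then have "?\<xi> \<bullet> (?g *v W) = 1/2 * dir_deriv (0, L \<eta> *v ?\<xi> - B l *v \<eta>) energy (x, \<eta>)"
      using linear_diff[OF lin, of "L \<eta> *v ?\<xi>" "B l *v \<eta>"] by (simp add: gW)
    also have "L \<eta> *v ?\<xi> - B l *v \<eta> = (\<Sum>j\<in>UNIV. u $ j *\<^sub>R (P *v (\<chi> k. C k l j)))"
    proof -
      have "L \<eta> *v ?\<xi> = (\<Sum>j\<in>UNIV. u $ j *\<^sub>R (B j *v ?\<xi>))"
        by (simp add: L_apply \<eta>_def PP)
      moreover have "B l *v \<eta> = (\<Sum>j\<in>UNIV. u $ j *\<^sub>R (B l *v (P *v axis j 1)))"
        using linear_axis_expansion[OF linear_compose[OF matrix_vector_mul_linear[of P]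
              matrix_vector_mul_linear[of "B l"]], of u] by (simp add: \<eta>_def)
      ultimately show ?thesis
        by (simp add: bracket[symmetric] sum_subtractf scaleR_right_diff_distrib)
    qed
    also have "\<dots> = P *v (\<Sum>j\<in>UNIV. u $ j *\<^sub>R (\<chi> k. C k l j))"
      by (simp add: linear_sum[OF matrix_vector_mul_linear] matrix_vector_mult_scaleR o_def)
    also have "1/2 * dir_deriv (0, P *v (\<Sum>j\<in>UNIV. u $ j *\<^sub>R (\<chi> k. C k l j))) energy (x, \<eta>) = c $ l"
      using linear_axis_expansion[OF linear_compose[OF matrix_vector_mul_linear[of P] lin],
          of "\<Sum>j\<in>UNIV. u $ j *\<^sub>R (\<chi> k. C k l j)"]
      by (simp add: c_def sum_distrib_right mult_ac)
    finally show ?thesis .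
  qed
  let ?G = "fundamental_tensor \<Phi> u"
  have frame: "partial_deriv k (\<lambda>z. (\<Phi> z)\<^sup>2) u = dir_deriv (0, P *v axis k 1) energy (x, \<eta>)"
    "?G = transpose P ** ?g ** P"
    "mean_cartan_coeff \<Phi> i u = dir_deriv (0, P *v axis i 1) log_density (x, \<eta>)" for i k
    unfolding \<Phi>_def \<eta>_def
    by (rule frame_partial_deriv[OF x P u] frame_tensor[OF x P u] frame_mean_cartan[OF x P u])+
  have "det ?G \<noteq> 0" using P det_tensor_pos[OF x \<eta>] by (simp add: frame(2) det_mul)
  note G_inv = matrix_inv_mult(2)[OF this]
  have "(transpose P *v (?g *v W)) $ l = c $ l" for l
    unfolding c[of l, symmetric] matrix_vector_mult_basis[of P]
    by (simp only: matrix_vector_mul_component transpose_def column_def vec_lambda_beta)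
  then have "?G *v (matrix_inv P *v W) = c"
    by (simp add: frame(2) vec_eq_iff PP flip: matrix_vector_mul_assoc)
  then have "matrix_inv ?G *v c = matrix_inv P *v W"
    by (metis G_inv matrix_vector_mul_assoc matrix_vector_mul_lid)
  then have W: "P *v (matrix_inv ?G *v c) = W" by (simp add: PP)
  have "dir_deriv (0, W) log_density (x, \<eta>) =
      (\<Sum>i\<in>UNIV. (matrix_inv ?G *v c) $ i * mean_cartan_coeff \<Phi> i u)"
    using linear_axis_expansion[OF linear_compose[OF matrix_vector_mul_linear[of P]
          linear_dir_deriv_snd[OF diff_log_density[OF x \<eta>]]], of "matrix_inv ?G *v c"]
    by (simp add: frame(3) W)
  also have "\<dots> = 1/2 * (\<Sum>i\<in>UNIV. \<Sum>l\<in>UNIV. \<Sum>k\<in>UNIV. \<Sum>j\<in>UNIV. matrix_inv ?G $ i $ l * C k l j *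
      partial_deriv k (\<lambda>z. (\<Phi> z)\<^sup>2) u * u $ j * mean_cartan_coeff \<Phi> i u)"
    unfolding frame(1) matrix_vector_mult_def[of "matrix_inv ?G" c]
    by (simp add: c_def sum_distrib_left sum_distrib_right mult_ac)
  finally show ?thesis using S by (simp add: \<eta>_def)
qed

end


section \<open>Charts and tangent vectors\<close>

lemma chart_facts:
  assumes "smooth_manifold M A" "c \<in> A"
  shows chart_dom_open: "open (chart_dom c)"
    and coord_inv_coord: "p \<in> chart_dom c \<Longrightarrow> coord_inv c (coord c p) = p"
    and coord_coord_inv: "x \<in> coord c ` chart_dom c \<Longrightarrow> coord c (coord_inv c x) = x"
    and coord_inv_in: "x \<in> coord c ` chart_dom c \<Longrightarrow> coord_inv c x \<in> chart_dom c"
    and chart_image_open: "open W \<Longrightarrow> open (coord c ` (chart_dom c \<inter> W))"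
    and continuous_coord_inv: "continuous_on (coord c ` chart_dom c) (coord_inv c)"
proof -
  have o: "open (chart_dom c)" "open (coord c ` chart_dom c)"
    and h: "homeomorphism (chart_dom c) (coord c ` chart_dom c) (coord c) (coord_inv c)"
    using assms by (auto simp: smooth_manifold_def)
  show "open (chart_dom c)" by (rule o)
  show inv: "coord_inv c (coord c p) = p" if "p \<in> chart_dom c" for p
    using homeomorphism_apply1[OF h that] .
  show "coord c (coord_inv c x) = x" if "x \<in> coord c ` chart_dom c" for x
    using homeomorphism_apply2[OF h that] .
  show "coord_inv c x \<in> chart_dom c" if "x \<in> coord c ` chart_dom c" for x
    using inv that by auto
  show cont: "continuous_on (coord c ` chart_dom c) (coord_inv c)"
    by (rule homeomorphism_cont2[OF h])
  show "open (coord c ` (chart_dom c \<inter> W))" if "open W"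
  proof -
    have "coord c ` (chart_dom c \<inter> W) = coord c ` chart_dom c \<inter> coord_inv c -` W"
      using inv by force
    then show ?thesis using continuous_open_preimage[OF cont o(2) that] by simp
  qed
qed

lemma transition_differentiable:
  assumes "smooth_manifold M A" "c \<in> A" "d \<in> A" "p \<in> chart_dom c" "p \<in> chart_dom d"
  shows "(coord d \<circ> coord_inv c) differentiable (at (coord c p))"
  using assms smooth_on_differentiable[of "coord c ` (chart_dom c \<inter> chart_dom d)"]
  unfolding smooth_manifold_def by blast

lemma transition_cocycle:
  assumes M: "smooth_manifold M A" and A: "c \<in> A" "d \<in> A" "e \<in> A"
    and p: "p \<in> chart_dom c" "p \<in> chart_dom d" "p \<in> chart_dom e"
  shows "frechet_derivative (coord e \<circ> coord_inv d) (at (coord d p))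
      (frechet_derivative (coord d \<circ> coord_inv c) (at (coord c p)) y) =
    frechet_derivative (coord e \<circ> coord_inv c) (at (coord c p)) y"
proof -
  have dc: "(coord d \<circ> coord_inv c) (coord c p) = coord d p"
    using coord_inv_coord[OF M A(1) p(1)] by simp
  have "frechet_derivative ((coord e \<circ> coord_inv d) \<circ> (coord d \<circ> coord_inv c)) (at (coord c p)) =
      frechet_derivative (coord e \<circ> coord_inv d) (at (coord d p)) \<circ>
      frechet_derivative (coord d \<circ> coord_inv c) (at (coord c p))"
    using frechet_derivative_compose[of "coord d \<circ> coord_inv c" "coord c p" "coord e \<circ> coord_inv d"]
      transition_differentiable[OF M] A p unfolding dc by blast
  moreover have "frechet_derivative (coord e \<circ> coord_inv c) (at (coord c p)) =
      frechet_derivative ((coord e \<circ> coord_inv d) \<circ> (coord d \<circ> coord_inv c)) (at (coord c p))"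
  proof (rule frechet_derivative_transform_within_open[OF transition_differentiable[OF M A(1,3) p(1,3)]])
    show "open (coord c ` (chart_dom c \<inter> chart_dom d))"
      by (rule chart_image_open[OF M A(1) chart_dom_open[OF M A(2)]])
    show "coord c p \<in> coord c ` (chart_dom c \<inter> chart_dom d)" using p by blast
    show "(coord e \<circ> coord_inv c) x = ((coord e \<circ> coord_inv d) \<circ> (coord d \<circ> coord_inv c)) x"
      if "x \<in> coord c ` (chart_dom c \<inter> chart_dom d)" for x
      using that coord_inv_coord[OF M A(1)] coord_inv_coord[OF M A(2)] by auto
  qed
  ultimately show ?thesis by simp
qed

lemma frechet_derivative_transition_same:
  assumes M: "smooth_manifold M A" and c: "c \<in> A" "p \<in> chart_dom c"
  shows "frechet_derivative (coord c \<circ> coord_inv c) (at (coord c p)) y = y"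
proof -
  have "open (coord c ` chart_dom c)"
    using chart_image_open[OF M c(1), of UNIV] by simp
  then have "((coord c \<circ> coord_inv c) has_derivative (\<lambda>y. y)) (at (coord c p))"
    using c coord_coord_inv[OF M c(1)]
    by (intro has_derivative_transform_within_open[OF has_derivative_ident]) auto
  from frechet_derivative_at[OF this, symmetric] show ?thesis by simp
qed

lemma tvec_of_coords_at:
  assumes "smooth_manifold M A" "c \<in> A" "p \<in> chart_dom c"
  shows "tvec_of_coords A c p y c = y"
  using assms frechet_derivative_transition_same[OF assms] by (simp add: tvec_of_coords_def)

lemma tvec_of_coords_tangent:
  assumes "smooth_manifold M A" "c \<in> A" "p \<in> chart_dom c"
  shows "tvec_of_coords A c p y \<in> tangent_space A p"
  using assms transition_cocycle[OF assms(1)] unfolding tangent_space_def tvec_of_coords_def by auto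

lemma tvec_of_coords_eq:
  assumes "c \<in> A" "p \<in> chart_dom c" "v \<in> tangent_space A p"
  shows "tvec_of_coords A c p (v c) = v"
proof
  fix d
  show "tvec_of_coords A c p (v c) d = v d"
  proof (cases "d \<in> A \<and> p \<in> chart_dom d")
    case True
    then have "v d = frechet_derivative (coord d \<circ> coord_inv c) (at (coord c p)) (v c)"
      using assms unfolding tangent_space_def by blast
    with True show ?thesis by (simp add: tvec_of_coords_def)
  next
    case False
    then have "v d = 0" using assms(3) unfolding tangent_space_def by blast
    with False show ?thesis by (auto simp: tvec_of_coords_def)
  qed
qed

lemma linear_tvec_of_coords:
  assumes "smooth_manifold M A" "c \<in> A" "p \<in> chart_dom c"
  shows "linear (\<lambda>y. tvec_of_coords A c p y d)"
proof (cases "d \<in> A \<and> p \<in> chart_dom d")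
  case True
  then show ?thesis
    using linear_frechet_derivative[OF transition_differentiable[OF assms(1,2) _ assms(3)]]
    by (simp add: tvec_of_coords_def eta_contract_eq)
next
  case False
  then show ?thesis by (auto simp: tvec_of_coords_def linear_iff)
qed

lemma frame_comb_eq_tvec_of_coords:
  assumes "smooth_manifold M A" "c \<in> A" "p \<in> chart_dom c" "\<And>i. X i p \<in> tangent_space A p"
  shows "frame_comb X p a = tvec_of_coords A c p (frame_comb X p a c)"
proof
  fix d
  note lin = linear_tvec_of_coords[OF assms(1-3)]
  show "frame_comb X p a d = tvec_of_coords A c p (frame_comb X p a c) d"
    unfolding frame_comb_def
    by (simp add: linear_sum[OF lin] linear_cmul[OF lin] tvec_of_coords_eq[OF assms(2,3,4)] o_def)
qed

lemma finsler_chart_local_rep: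
  fixes A :: "('a::{t2_space,second_countable_topology}, 'n::finite) chart set"
  assumes M: "smooth_manifold M A" and F: "finsler_metric M A F" and c: "c \<in> A"
  shows "finsler_chart (coord c ` chart_dom c) (local_rep A F c)"
proof
  show "open (coord c ` chart_dom c)"
    using chart_image_open[OF M c, of UNIV] by simp
  show "smooth_on (coord c ` chart_dom c \<times> - {0}) (\<lambda>(x, y). local_rep A F c x y)"
    using F c by (simp add: finsler_metric_def)
  fix x and y :: "real^'n" assume x: "x \<in> coord c ` chart_dom c" and y: "y \<noteq> 0"
  have p: "coord_inv c x \<in> chart_dom c" by (rule coord_inv_in[OF M c x])
  have "chart_dom c \<subseteq> M" using M c by (auto simp: smooth_manifold_def)
  with p have pM: "coord_inv c x \<in> M" by blast
  let ?v = "tvec_of_coords A c (coord_inv c x) y"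
  have v: "?v \<in> tangent_space A (coord_inv c x)" by (rule tvec_of_coords_tangent[OF M c p])
  have v0: "?v \<noteq> (\<lambda>_. 0)"
    using tvec_of_coords_at[OF M c p, of y] y fun_cong[of ?v "\<lambda>_. 0" c] by metis
  show "0 < local_rep A F c x y"
    using F pM v v0 unfolding finsler_metric_def local_rep_def by blast
  show "local_rep A F c x (r *\<^sub>R y) = r * local_rep A F c x y" if "r > 0" for r
  proof -
    have "tvec_of_coords A c (coord_inv c x) (r *\<^sub>R y) = (\<lambda>d. r *\<^sub>R ?v d)"
      by (simp add: fun_eq_iff linear_cmul[OF linear_tvec_of_coords[OF M c p]])
    moreover have "\<forall>p\<in>M. \<forall>v\<in>tangent_space A p. \<forall>r>0. v \<noteq> (\<lambda>_. 0) \<longrightarrow>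
        F p (\<lambda>c. r *\<^sub>R v c) = r * F p v"
      using F by (simp add: finsler_metric_def)
    then have "F (coord_inv c x) (\<lambda>d. r *\<^sub>R ?v d) = r * F (coord_inv c x) ?v"
      using pM v v0 that by blast
    ultimately show ?thesis by (simp add: local_rep_def)
  qed
  show "0 < u \<bullet> (fundamental_tensor (local_rep A F c x) y *v u)" if "u \<noteq> 0" for u
    using F c x y that unfolding finsler_metric_def by blast
qed


section \<open>Killing fields in a chart\<close>

text \<open>The fibre part is the time derivative of the spatial derivative of the flow; the two are
  interchanged, and the time derivative of the flow is \<open>X\<close>. The chart \<open>b\<close> in which the
  differential is computed may differ from \<open>c\<close>, so the chain rule for their transition enters.\<close>

lemma lifted_field_eq:
  fixes p :: "'a::{t2_space,second_countable_topology}" and A :: "('a, 'n::finite) chart set"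
  assumes M: "smooth_manifold M A" and X: "smooth_vfield_on A U X" and U: "open U"
    and flow: "local_flow A U X p \<rho>" and c: "c \<in> A" "p \<in> chart_dom c"
    and v: "v \<in> tangent_space A p"
  shows "lifted_field A \<rho> c p v =
    (X p c, frechet_derivative (\<lambda>x. X (coord_inv c x) c) (at (coord c p)) (v c))"
proof -
  define b where "b = (SOME c. c \<in> A \<and> p \<in> chart_dom c)"
  have b: "b \<in> A" "p \<in> chart_dom b"
    using someI[of "\<lambda>c. c \<in> A \<and> p \<in> chart_dom c" c] c unfolding b_def by auto
  obtain \<epsilon> W where \<epsilon>: "\<epsilon> > 0" and W: "open W" "p \<in> W" "W \<subseteq> U"
    and \<rho>0': "\<forall>q\<in>W. \<rho> 0 q = q"
    and cont: "continuous_on ({-\<epsilon><..<\<epsilon>} \<times> W) (\<lambda>(t, q). \<rho> t q)"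
    and smooth: "\<forall>c\<in>A. \<forall>d\<in>A.
        smooth_on {(t, x). t \<in> {-\<epsilon><..<\<epsilon>} \<and> x \<in> coord c ` (chart_dom c \<inter> W) \<and>
                           \<rho> t (coord_inv c x) \<in> chart_dom d}
          (\<lambda>(t, x). coord d (\<rho> t (coord_inv c x)))"
    and ode': "\<forall>t\<in>{-\<epsilon><..<\<epsilon>}. \<forall>q\<in>W. \<forall>c\<in>A. \<rho> t q \<in> chart_dom c \<longrightarrow>
        ((\<lambda>s. coord c (\<rho> s q)) has_vector_derivative X (\<rho> t q) c) (at t)"
    using flow unfolding local_flow_def by (elim exE conjE) (rule that; assumption)
  have \<rho>0: "\<rho> 0 q = q" if "q \<in> W" for q using \<rho>0' that by (rule bspec)
  have ode: "((\<lambda>s. coord c (\<rho> s q)) has_vector_derivative X (\<rho> t q) c) (at t)"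
    if "t \<in> {-\<epsilon><..<\<epsilon>}" "q \<in> W" "c \<in> A" "\<rho> t q \<in> chart_dom c" for t q c
    using ode'[THEN bspec, OF that(1), THEN bspec, OF that(2), THEN bspec, OF that(3)] that(4) ..
  define \<phi> where "\<phi> = (\<lambda>(t, x). coord c (\<rho> t (coord_inv b x)))"
  define O1 where "O1 = coord b ` (chart_dom b \<inter> W)"
  define \<Omega> where "\<Omega> = {(t, x). t \<in> {-\<epsilon><..<\<epsilon>} \<and> x \<in> O1 \<and> \<rho> t (coord_inv b x) \<in> chart_dom c}"
  let ?x = "coord b p"
  have O1: "open O1" "?x \<in> O1"
    using chart_image_open[OF M b(1) W(1)] b W unfolding O1_def by auto
  have inW: "coord_inv b x \<in> W" if "x \<in> O1" for x
    using that coord_inv_coord[OF M b(1)] unfolding O1_def by auto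
  have "open \<Omega>"
  proof -
    let ?g = "\<lambda>z. \<rho> (fst z) (coord_inv b (snd z))"
    have "continuous_on ({-\<epsilon><..<\<epsilon>} \<times> O1) (\<lambda>z. coord_inv b (snd z))"
      by (rule continuous_on_compose2[OF continuous_coord_inv[OF M b(1)] continuous_on_snd])
         (auto simp: O1_def continuous_on_id)
    then have "continuous_on ({-\<epsilon><..<\<epsilon>} \<times> O1) (\<lambda>z. (fst z, coord_inv b (snd z)))"
      by (intro continuous_intros)
    from continuous_on_compose2[OF cont this] inW
    have "continuous_on ({-\<epsilon><..<\<epsilon>} \<times> O1) ?g"
      by (force simp: case_prod_unfold)
    then have "open (({-\<epsilon><..<\<epsilon>} \<times> O1) \<inter> ?g -` chart_dom c)"
      by (intro continuous_open_preimage chart_dom_open[OF M c(1)] open_Times O1) auto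
    moreover have "({-\<epsilon><..<\<epsilon>} \<times> O1) \<inter> ?g -` chart_dom c = \<Omega>"
      by (auto simp: \<Omega>_def)
    ultimately show ?thesis by simp
  qed
  have smooth_\<phi>: "smooth_on \<Omega> \<phi>"
    using smooth[THEN bspec, OF b(1), THEN bspec, OF c(1)] unfolding \<Omega>_def O1_def \<phi>_def .
  note diff = smooth_on_differentiable[OF smooth_\<phi>]
    smooth_on_differentiable[OF smooth_on_dir_deriv[OF smooth_\<phi>]]
  have px: "coord_inv b ?x = p" by (rule coord_inv_coord[OF M b])
  have \<Omega>0: "(0, ?x) \<in> \<Omega>"
    using \<epsilon> O1 c \<rho>0[OF W(2)] by (simp add: \<Omega>_def px)
  \<comment> \<open>The base part is the equation of the flow.\<close>
  have base: "((\<lambda>t. coord c (\<rho> t p)) has_vector_derivative X p c) (at 0)"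
    using ode[of 0 p c] \<epsilon> W c \<rho>0[OF W(2)] by simp
  have fibre: "((\<lambda>t. differential A (\<rho> t) p v c) has_vector_derivative
      dir_deriv (1, 0) (dir_deriv (0, v b) \<phi>) (0, ?x)) (at 0)"
  proof -
    note d = diff(2)[OF \<Omega>0, of "(0, v b)"]
    have 1: "((\<lambda>t. dir_deriv (0, v b) \<phi> (t, ?x)) has_vector_derivative
        dir_deriv (1, 0) (dir_deriv (0, v b) \<phi>) (0, ?x)) (at 0)"
    proof -
      have "h *\<^sub>R dir_deriv (1, 0) (dir_deriv (0, v b) \<phi>) (0, ?x) =
          dir_deriv (h, 0) (dir_deriv (0, v b) \<phi>) (0, ?x)" for h :: real
        using linear_cmul[OF linear_dir_deriv_fst[OF d], of h 1] by simp
      then show ?thesis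
        using has_derivative_dir_deriv[OF differentiable_fst_var[OF d]]
        by (simp only: has_vector_derivative_def dir_deriv_fst_var[OF d])
    qed
    have "open {t. (t, ?x) \<in> \<Omega>}"
      using open_vimage[OF \<open>open \<Omega>\<close>, of "\<lambda>t. (t, ?x)"] by (simp add: vimage_def continuous_intros)
    from 1 this show ?thesis
    proof (rule has_vector_derivative_transform_within_open)
      fix t assume "t \<in> {t. (t, ?x) \<in> \<Omega>}"
      then have t: "(t, ?x) \<in> \<Omega>" by simp
      then have "\<rho> t p \<in> chart_dom c" by (simp add: \<Omega>_def px)
      then have "differential A (\<rho> t) p v c = dir_deriv (v b) (\<lambda>x. \<phi> (t, x)) ?x"
        using c(1) by (simp add: differential_def Let_def b_def[symmetric] dir_deriv_def \<phi>_def o_def)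
      then show "dir_deriv (0, v b) \<phi> (t, ?x) = differential A (\<rho> t) p v c"
        by (simp add: dir_deriv_snd_var[OF diff(1)[OF t]])
    qed (use \<Omega>0 in simp)
  qed
  have "dir_deriv (1, 0) (dir_deriv (0, v b) \<phi>) (0, ?x) =
      dir_deriv (0, v b) (dir_deriv (1, 0) \<phi>) (0, ?x)"
    by (rule dir_deriv_commute[OF \<open>open \<Omega>\<close> \<Omega>0 smooth_\<phi>])
  also have "\<dots> = dir_deriv (v b) (\<lambda>x. dir_deriv (1, 0) \<phi> (0, x)) ?x"
    by (rule dir_deriv_snd_var[OF diff(2)[OF \<Omega>0], symmetric])
  also have "\<dots> = dir_deriv (v b) (\<lambda>x. X (coord_inv c ((coord c \<circ> coord_inv b) x)) c) ?x"
  proof (rule dir_deriv_cong_open[symmetric])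
    show "open {x. (0, x) \<in> \<Omega>}"
      using open_vimage[OF \<open>open \<Omega>\<close>, of "\<lambda>x. (0, x)"] by (simp add: vimage_def continuous_intros)
    show "?x \<in> {x. (0, x) \<in> \<Omega>}" using \<Omega>0 by simp
    show "(\<lambda>x. dir_deriv (1, 0) \<phi> (0, x)) differentiable (at ?x)"
      by (rule differentiable_snd_var[OF diff(2)[OF \<Omega>0]])
    fix x assume "x \<in> {x. (0, x) \<in> \<Omega>}"
    then have x: "(0, x) \<in> \<Omega>" by simp
    let ?q = "coord_inv b x"
    have q: "?q \<in> W" "\<rho> 0 ?q = ?q" "?q \<in> chart_dom c"
      using x inW[of x] \<rho>0[of ?q] by (auto simp: \<Omega>_def)
    have "((\<lambda>s. \<phi> (s, x)) has_derivative (\<lambda>h. h *\<^sub>R X ?q c)) (at 0)"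
      using ode[of 0 ?q c] \<epsilon> q c(1) by (simp add: has_vector_derivative_def \<phi>_def)
    from dir_deriv_eqI[OF this, of 1] have "dir_deriv (1, 0) \<phi> (0, x) = X ?q c"
      by (simp add: dir_deriv_fst_var[OF diff(1)[OF x]])
    then show "dir_deriv (1, 0) \<phi> (0, x) = X (coord_inv c ((coord c \<circ> coord_inv b) x)) c"
      using coord_inv_coord[OF M c(1) q(3)] by simp
  qed
  also have "\<dots> = dir_deriv (frechet_derivative (coord c \<circ> coord_inv b) (at ?x) (v b))
      (\<lambda>x. X (coord_inv c x) c) (coord c p)"
  proof -
    have t: "((coord c \<circ> coord_inv b) has_derivative
        frechet_derivative (coord c \<circ> coord_inv b) (at ?x)) (at ?x)"
      using transition_differentiable[OF M b(1) c(1) b(2) c(2)] by (simp add: frechet_derivative_works)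
    have "coord c p \<in> coord c ` (chart_dom c \<inter> U)" using c W by blast
    then have "(\<lambda>x. X (coord_inv c x) c) differentiable (at (coord c p))"
      using X c(1) smooth_on_differentiable unfolding smooth_vfield_on_def by blast
    then show ?thesis using dir_deriv_chain[OF t, of "\<lambda>x. X (coord_inv c x) c" "v b"] px by simp
  qed
  also have "frechet_derivative (coord c \<circ> coord_inv b) (at ?x) (v b) = v c"
  proof -
    have "v c = frechet_derivative (coord c \<circ> coord_inv b) (at ?x) (v b)"
      using v b c unfolding tangent_space_def by blast
    then show ?thesis by (rule sym)
  qed
  finally have "dir_deriv (1, 0) (dir_deriv (0, v b) \<phi>) (0, ?x) =
      frechet_derivative (\<lambda>x. X (coord_inv c x) c) (at (coord c p)) (v c)"
    by (simp add: dir_deriv_def)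
  with vector_derivative_at[OF has_vector_derivative_Pair[OF base fibre]]
  show ?thesis unfolding lifted_field_def by simp
qed

text \<open>Being a Killing field thus becomes, in a chart, the invariance that the preceding sections
  start from.\<close>

lemma killing_equation:
  fixes A :: "('a::{t2_space,second_countable_topology}, 'n::finite) chart set"
  assumes M: "smooth_manifold M A" and X: "killing_field_on A F U X" and U: "open U" "p \<in> U"
    and c: "c \<in> A" "p \<in> chart_dom c" and y: "y \<noteq> 0"
  shows "dir_deriv (X p c, frechet_derivative (\<lambda>x. X (coord_inv c x) c) (at (coord c p)) y)
    (\<lambda>(x, y). local_rep A F c x y) (coord c p, y) = 0"
proof -
  let ?v = "tvec_of_coords A c p y"
  have v: "?v \<in> tangent_space A p" "?v c = y"
    using tvec_of_coords_tangent[OF M c] tvec_of_coords_at[OF M c] by blast+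
  have v0: "?v \<noteq> (\<lambda>_. 0)" using v(2) y fun_cong[of ?v "\<lambda>_. 0" c] by metis
  have smooth: "smooth_vfield_on A U X" using X by (simp add: killing_field_on_def)
  obtain \<rho> where \<rho>: "local_flow A U X p \<rho>" and
    "frechet_derivative (\<lambda>(x, y). local_rep A F c x y) (at (coord c p, ?v c))
       (lifted_field A \<rho> c p ?v) = 0"
    using X U(2) v(1) v0 c unfolding killing_field_on_def by blast
  then show ?thesis
    using lifted_field_eq[OF M smooth U(1) \<rho> c v(1)] v(2) by (simp add: dir_deriv_def)
qed

theorem theorem4p1:
  fixes M U :: "'a::{t2_space,second_countable_topology} set"
    and A :: "('a, 'n::finite) chart set"
    and F :: "'a \<Rightarrow> ('a, 'n) tvec \<Rightarrow> real"
    and X :: "'n \<Rightarrow> ('a, 'n) vfield"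
    and C :: "'n \<Rightarrow> 'n \<Rightarrow> 'n \<Rightarrow> real"
    and \<Phi> :: "real^'n \<Rightarrow> real"
    and y :: "real^'n"
  assumes manifold: "smooth_manifold M A"
    and finsler: "finsler_metric M A F"
    and x: "x \<in> U"
    and frame: "killing_frame_on M A F U X"
    and structure_constants:
      "\<And>l j. lie_bracket A (X l) (X j) x = frame_comb X x (\<chi> k. C k l j)"
    and v: "v \<in> tangent_space A x" "v \<noteq> (\<lambda>_. 0)"
    and coordinates: "v = frame_comb X x y"
    and metric_in_frame: "\<Phi> = (\<lambda>z. F x (frame_comb X x z))"
    and chart: "c \<in> A" "x \<in> chart_dom c"
  shows "S_curvature A F c x v =
    1/2 * (\<Sum>i\<in>UNIV. \<Sum>l\<in>UNIV. \<Sum>k\<in>UNIV. \<Sum>j\<in>UNIV.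
      matrix_inv (fundamental_tensor \<Phi> y) $ i $ l * C k l j *
      partial_deriv k (\<lambda>z. (\<Phi> z)\<^sup>2) y * y $ j * mean_cartan_coeff \<Phi> i y)"
proof -
  interpret H: finsler_chart "coord c ` chart_dom c" "local_rep A F c"
    by (rule finsler_chart_local_rep[OF manifold finsler chart(1)])
  have U: "open U" and killing: "killing_field_on A F U (X i)"
    and basis: "w \<in> tangent_space A x \<Longrightarrow> \<exists>!a. w = frame_comb X x a" for i w
    using frame x by (auto simp: killing_frame_on_def)
  have smooth: "smooth_vfield_on A U (X i)" for i
    using killing by (simp add: killing_field_on_def)
  have tangent: "X i x \<in> tangent_space A x" for i
    using smooth x by (simp add: smooth_vfield_on_def)
  have \<xi>: "coord c x \<in> coord c ` chart_dom c" using chart by blast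
  define P :: "real^'n^'n" where "P = (\<chi> a i. X i x c $ a)"
  have P: "P *v z = frame_comb X x z c" for z
    by (simp add: P_def frame_comb_def matrix_vector_mult_def vec_eq_iff mult.commute)
  have P_axis: "P *v axis i 1 = X i x c" for i
    by (simp add: matrix_vector_mult_basis P_def column_def)
  have frame_comb: "frame_comb X x z = tvec_of_coords A c x (P *v z)" for z
    unfolding P by (rule frame_comb_eq_tvec_of_coords[OF manifold chart]) (rule tangent)
  have det: "det P \<noteq> 0"
    unfolding invertible_det_nz[symmetric] invertible_left_inverse matrix_left_invertible_ker
  proof (intro allI impI)
    fix z assume "P *v z = 0"
    then have "frame_comb X x z = frame_comb X x 0" by (simp add: frame_comb)
    moreover have "frame_comb X x z \<in> tangent_space A x"
      unfolding frame_comb by (rule tvec_of_coords_tangent[OF manifold chart])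
    ultimately show "z = 0" using basis by metis
  qed
  have y: "y \<noteq> 0"
  proof
    assume "y = 0"
    then have "v = (\<lambda>_. 0)" by (simp add: coordinates frame_comb_def)
    with v(2) show False ..
  qed
  let ?D = "\<lambda>i. frechet_derivative (\<lambda>x. X i (coord_inv c x) c) (at (coord c x))"
  have D: "matrix (?D i) *v w = ?D i w" for i w
  proof -
    have "coord c x \<in> coord c ` (chart_dom c \<inter> U)" using chart x by blast
    then have "(\<lambda>x. X i (coord_inv c x) c) differentiable (at (coord c x))"
      using smooth[of i] chart(1) smooth_on_differentiable unfolding smooth_vfield_on_def by blast
    then have "linear (?D i)" by (rule linear_frechet_derivative)
    then show ?thesis by simp
  qed
  have S: "S_curvature A F c x v =
      spray_apply (local_rep A F c) (distortion (local_rep A F c)) (coord c x) (P *v y)"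
    by (simp add: S_curvature_def coordinates P)
  have \<Phi>: "\<Phi> = (\<lambda>z. local_rep A F c (coord c x) (P *v z))"
    by (simp add: metric_in_frame local_rep_def frame_comb coord_inv_coord[OF manifold chart])
  show ?thesis
    unfolding S \<Phi>
  proof (rule H.S_curvature_from_killing_frame[OF \<xi> det y])
    show "dir_deriv (P *v axis i 1, matrix (?D i) *v w)
        (\<lambda>(x, y). local_rep A F c x y) (coord c x, w) = 0" if "w \<noteq> 0" for i w
      unfolding P_axis D by (rule killing_equation[OF manifold killing U x chart that])
    show "matrix (?D j) *v (P *v axis l 1) - matrix (?D l) *v (P *v axis j 1) =
        P *v (\<chi> k. C k l j)" for l j
      unfolding P_axis D unfolding P
      using fun_cong[OF structure_constants[of l j], of c] chart
      by (simp add: lie_bracket_def)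
  qed
qed

end
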